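(* Let $k\ge 1$ be an integer and $p\in[1,\infty)$. Then for every $A\in M_n(\mathbb{C})$, $$c_{n,k}^{\frac{1}{kp}}\,N_k^{(p)}(A)=\big\lVert \vee^k A\big\rVert_{(p)}^{\frac1k}.$$
   Context: $\mathbb{S}^n$ denotes the unit sphere of $\mathbb{C}^n$, $\sigma$ the normalized Euclidean surface measure on it, $\langle\cdot,\cdot\rangle$ the standard Hermitian inner product on $\mathbb{C}^n$, and $|A|=\sqrt{A^\star A}$. For real $q\ge 1$, $p\ge1$, $$N_q^{(p)}(A)=\Bigg(\int_{\mathbb{S}^n}\big(\langle |A|^p\xi,\xi\rangle\big)^q\,d\sigma(\xi)\Bigg)^{\frac1{pq}}.$$ $\vee^kA$ is the $k$-th symmetric tensor power of $A$, acting on the $k$-th symmetric tensor power of $\mathbb{C}^n$ (with the inner product inherited from $(\mathbb{C}^n)^{\otimes k}$), a space of dimension $c_{n,k}=\binom{n+k-1}{k}$. $\lVert B\rVert_{(p)}=[\mathrm{tr}(|B|^p)]^{1/p}$ is the Schatten $p$-norm. *)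

theory Defs
  imports "HOL-Analysis.Analysis" "HOL-Probability.Probability_Measure"
begin

section \<open>Operators on subspaces of a finite-dimensional Hermitian space\<close>

text \<open>
  An operator on a complex subspace \<open>V\<close> of \<open>complex ^ 'a\<close> is represented by a function on
  \<open>complex ^ 'a\<close> that is linear on \<open>V\<close> and maps \<open>V\<close> to itself; its values outside \<open>V\<close> are
  irrelevant.  The inner product of \<open>V\<close> is the one inherited from \<open>complex ^ 'a\<close>.  The library
  inner product on this type is real-valued (the real part of the Hermitian one).
\<close>

definition hinner :: "complex ^ 'a \<Rightarrow> complex ^ 'a \<Rightarrow> complex" where
  "hinner x y = (\<Sum>i\<in>UNIV. x $ i * cnj (y $ i))"

definition adjoint_on ::
  "(complex ^ 'a) set \<Rightarrow> (complex ^ 'a \<Rightarrow> complex ^ 'a) \<Rightarrow> complex ^ 'a \<Rightarrow> complex ^ 'a" where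
  "adjoint_on V T x = (THE z. z \<in> V \<and> (\<forall>y\<in>V. hinner (T y) x = hinner y z))"

definition orth_proj :: "(complex ^ 'a) set \<Rightarrow> complex ^ 'a \<Rightarrow> complex ^ 'a" where
  "orth_proj E x = (THE y. y \<in> E \<and> (\<forall>z\<in>E. hinner (x - y) z = 0))"

definition eigenspace_on ::
  "(complex ^ 'a) set \<Rightarrow> (complex ^ 'a \<Rightarrow> complex ^ 'a) \<Rightarrow> complex \<Rightarrow> (complex ^ 'a) set" where
  "eigenspace_on V T l = {v \<in> V. T v = l *s v}"

definition eigenvalues_on ::
  "(complex ^ 'a) set \<Rightarrow> (complex ^ 'a \<Rightarrow> complex ^ 'a) \<Rightarrow> complex set" where
  "eigenvalues_on V T = {l. \<exists>v\<in>eigenspace_on V T l. v \<noteq> 0}"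

text \<open>
  The real power \<open>T\<^sup>r\<close> (\<open>r > 0\<close>) of a positive semidefinite operator \<open>T\<close> on \<open>V\<close>, by the
  functional calculus: the eigenvalues \<open>l\<close> of \<open>T\<close> are replaced by \<open>l\<^sup>r\<close> in its spectral
  decomposition.  All eigenvalues of such a \<open>T\<close> are real, and \<open>0 powr r = 0\<close>.
\<close>

definition op_powr ::
  "(complex ^ 'a) set \<Rightarrow> (complex ^ 'a \<Rightarrow> complex ^ 'a) \<Rightarrow> real \<Rightarrow> complex ^ 'a \<Rightarrow> complex ^ 'a" where
  "op_powr V T r x =
     (\<Sum>l | complex_of_real l \<in> eigenvalues_on V T.
        complex_of_real (l powr r) *s orth_proj (eigenspace_on V T (complex_of_real l)) x)"

definition op_abs ::
  "(complex ^ 'a) set \<Rightarrow> (complex ^ 'a \<Rightarrow> complex ^ 'a) \<Rightarrow> complex ^ 'a \<Rightarrow> complex ^ 'a" where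
  "op_abs V T = op_powr V (adjoint_on V T \<circ> T) (1/2)"

definition orthonormal_basis_of :: "(complex ^ 'a) set \<Rightarrow> (complex ^ 'a) set \<Rightarrow> bool" where
  "orthonormal_basis_of V B \<longleftrightarrow>
     vec.span B = V \<and> (\<forall>b\<in>B. \<forall>c\<in>B. hinner b c = (if b = c then 1 else 0))"

definition trace_on ::
  "(complex ^ 'a) set \<Rightarrow> (complex ^ 'a \<Rightarrow> complex ^ 'a) \<Rightarrow> complex" where
  "trace_on V T = (\<Sum>e \<in> (SOME B. orthonormal_basis_of V B). hinner (T e) e)"

definition schatten_norm ::
  "real \<Rightarrow> (complex ^ 'a) set \<Rightarrow> (complex ^ 'a \<Rightarrow> complex ^ 'a) \<Rightarrow> real" where
  "schatten_norm p V T = Re (trace_on V (op_powr V (op_abs V T) p)) powr (1 / p)"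


section \<open>Symmetric tensor powers\<close>

text \<open>
  The \<open>k\<close>-th tensor power of \<open>complex ^ 'n\<close>, with \<open>k = CARD('k)\<close>, is \<open>complex ^ ('k \<Rightarrow> 'n)\<close>:
  the index \<open>f :: 'k \<Rightarrow> 'n\<close> stands for the tensor product of the standard basis vectors
  \<open>e\<^bsub>f i\<^esub>\<close>.
\<close>

definition elementary_tensor ::
  "('k::finite \<Rightarrow> complex ^ 'n::finite) \<Rightarrow> complex ^ ('k \<Rightarrow> 'n)" where
  "elementary_tensor x = (\<chi> f. \<Prod>i\<in>UNIV. x i $ f i)"

definition tensor_power ::
  "complex ^ 'n::finite ^ 'n \<Rightarrow> complex ^ ('k::finite \<Rightarrow> 'n) ^ ('k \<Rightarrow> 'n)" where
  "tensor_power A = (\<chi> f g. \<Prod>i\<in>UNIV. A $ f i $ g i)"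

definition sym_tensors :: "(complex ^ ('k::finite \<Rightarrow> 'n::finite)) set" where
  "sym_tensors = {t. \<forall>\<pi>. bij \<pi> \<longrightarrow> (\<forall>f. t $ (f \<circ> \<pi>) = t $ f)}"

definition sym_power ::
  "complex ^ 'n::finite ^ 'n \<Rightarrow> complex ^ ('k::finite \<Rightarrow> 'n) \<Rightarrow> complex ^ ('k \<Rightarrow> 'n)" where
  "sym_power A = restrict (\<lambda>t. tensor_power A *v t) sym_tensors"

lemma hinner_elementary_tensor:
  "hinner (elementary_tensor x) (elementary_tensor y) = (\<Prod>i\<in>UNIV. hinner (x i) (y i))"
proof -
  have "(\<Prod>i\<in>UNIV. hinner (x i) (y i)) =
      (\<Sum>f \<in> (\<Pi>\<^sub>E i\<in>UNIV. UNIV). \<Prod>i\<in>UNIV. x i $ f i * cnj (y i $ f i))"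
    unfolding hinner_def by (rule prod_sum_PiE) auto
  then show ?thesis
    by (simp add: hinner_def elementary_tensor_def prod.distrib)
qed

lemma tensor_power_elementary_tensor:
  "tensor_power A *v elementary_tensor x = elementary_tensor (\<lambda>i. A *v x i)"
proof -
  have "(\<Prod>i\<in>UNIV. \<Sum>j\<in>UNIV. A $ f i $ j * x i $ j) =
      (\<Sum>g \<in> (\<Pi>\<^sub>E i\<in>UNIV. UNIV). \<Prod>i\<in>UNIV. A $ f i $ g i * x i $ g i)" for f
    by (rule prod_sum_PiE) auto
  then show ?thesis
    by (simp add: vec_eq_iff matrix_vector_mult_def tensor_power_def elementary_tensor_def
        prod.distrib)
qed

lemma subspace_sym_tensors: "vec.subspace sym_tensors"
  by (simp add: vec.subspace_def sym_tensors_def)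

lemma sym_power_in_sym_tensors:
  assumes "t \<in> sym_tensors"
  shows "sym_power A t \<in> sym_tensors"
proof -
  have "(\<Sum>g\<in>UNIV. (\<Prod>i\<in>UNIV. A $ f (\<pi> i) $ g i) * t $ g) =
        (\<Sum>g\<in>UNIV. (\<Prod>i\<in>UNIV. A $ f i $ g i) * t $ g)" if "bij \<pi>" for \<pi> f
  proof -
    have *: "bij (\<lambda>g. g \<circ> \<pi>)"
      by (rule o_bij[where g = "\<lambda>g. g \<circ> inv \<pi>"])
        (use that in \<open>auto simp: fun_eq_iff bij_is_inj bij_is_surj surj_f_inv_f\<close>)
    have "(\<Sum>g\<in>UNIV. (\<Prod>i\<in>UNIV. A $ f (\<pi> i) $ g i) * t $ g) =
        (\<Sum>g\<in>UNIV. (\<Prod>i\<in>UNIV. A $ f (\<pi> i) $ (g \<circ> \<pi>) i) * t $ (g \<circ> \<pi>))"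
      by (rule sum.reindex_bij_betw[OF *, symmetric])
    also have "\<dots> = (\<Sum>g\<in>UNIV. (\<Prod>i\<in>UNIV. A $ f i $ g i) * t $ g)"
      using assms that prod.reindex_bij_betw[OF that, of "\<lambda>i. A $ f i $ _ i"]
      by (simp add: sym_tensors_def)
    finally show ?thesis .
  qed
  then show ?thesis
    using assms unfolding sym_power_def
    by (simp add: sym_tensors_def matrix_vector_mult_def tensor_power_def)
qed


section \<open>Integration over the unit sphere\<close>

text \<open>
  The normalized surface measure of the unit sphere, as a Borel measure on the ambient space
  concentrated on the sphere.  In polar coordinates, the surface area of a Borel set \<open>E\<close> of unit
  vectors is the dimension times the volume of the cone \<open>{r x | 0 < r \<le> 1, x \<in> E}\<close> over \<open>E\<close>, so
  the normalized surface measure is the image of the uniform distribution on the unit ball under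
  the radial projection \<open>sgn x = x / norm x\<close>.
\<close>

definition sphere_measure :: "'a::euclidean_space measure" where
  "sphere_measure = distr (uniform_measure lborel (cball 0 1)) borel sgn"

lemma sgn_borel_measurable: "(sgn :: 'a::euclidean_space \<Rightarrow> 'a) \<in> borel_measurable borel"
  unfolding sgn_div_norm by measurable

lemma emeasure_cball_pos: "0 < emeasure lborel (cball 0 1 :: 'a::euclidean_space set)"
proof -
  have "0 < measure lborel (cball 0 1 :: 'a set)"
    by (rule content_cball_pos) simp
  then show ?thesis
    by (metis less_irrefl measure_eq_0_null_sets null_setsI sets_lborel borel_closed closed_cball
        zero_less_iff_neq_zero)
qed

lemma emeasure_sphere_measure:
  fixes E :: "'a::euclidean_space set"
  assumes "E \<in> sets borel" "E \<subseteq> sphere 0 1"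
  shows "emeasure sphere_measure E =
    emeasure lborel {r *\<^sub>R x | r x. 0 < r \<and> r \<le> 1 \<and> x \<in> E} / emeasure lborel (cball 0 1 :: 'a set)"
proof -
  have "cball 0 1 \<inter> sgn -` E = {r *\<^sub>R x | r x. 0 < r \<and> r \<le> 1 \<and> x \<in> E}" (is "?L = ?R")
  proof (intro equalityI subsetI)
    fix y assume y: "y \<in> ?L"
    then have "y \<noteq> 0"
      using assms(2) by auto
    then have "y = norm y *\<^sub>R sgn y" "0 < norm y" "norm y \<le> 1" "sgn y \<in> E"
      using y by (auto simp: sgn_div_norm)
    then show "y \<in> ?R" by blast
  next
    fix y assume "y \<in> ?R"
    then obtain r x where "y = r *\<^sub>R x" "0 < r" "r \<le> 1" "x \<in> E" by blast
    moreover from this have "norm x = 1"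
      using assms(2) by auto
    ultimately show "y \<in> ?L"
      by (auto simp: sgn_div_norm)
  qed
  moreover have "sgn -` E \<in> sets borel"
    using measurable_sets[OF sgn_borel_measurable assms(1)] by simp
  moreover have "sgn \<in> measurable (uniform_measure lborel (cball 0 1)) (borel :: 'a measure)"
    using sgn_borel_measurable by simp
  ultimately show ?thesis
    using assms(1) by (simp add: sphere_measure_def emeasure_distr)
qed

lemma prob_space_sphere_measure: "prob_space (sphere_measure :: 'a::euclidean_space measure)"
proof -
  have "prob_space (uniform_measure lborel (cball 0 1 :: 'a set))"
    using emeasure_cball_pos[where 'a='a] emeasure_compact_finite[of "cball 0 1 :: 'a set"]
    by (intro prob_space_uniform_measure) auto
  then show ?thesis
    unfolding sphere_measure_def
    by (rule prob_space.prob_space_distr) (use sgn_borel_measurable in simp)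
qed

definition N_norm :: "real \<Rightarrow> real \<Rightarrow> complex ^ 'n::finite ^ 'n \<Rightarrow> real" where
  "N_norm q p A =
     (LINT \<xi>:sphere 0 1|sphere_measure.
        Re (hinner (op_powr UNIV (op_abs UNIV ((*v) A)) p \<xi>) \<xi>) powr q) powr (1 / (p * q))"

end

theory Submission
  imports Defs "HOL-Probability.Distributions" "HOL-Combinatorics.Multiset_Permutations"
begin

text \<open>
  Diagonalise \<open>A\<^sup>\<star>A\<close> in an orthonormal basis \<open>e\<close> and let \<open>w\<^sub>j\<close> be the \<open>p\<close>-th powers of the
  singular values.  Both sides reduce to the complete homogeneous symmetric polynomial
  \<open>h\<^sub>k(w) = \<Sum>\<^bsub>M\<^esub> \<Prod>\<^bsub>j \<in> M\<^esub> w\<^sub>j\<close>, where \<open>M\<close> ranges over the multisets of size \<open>k\<close>.  The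
  symmetrised tensors of the \<open>e\<^sub>j\<close> are an eigenbasis of \<open>|\<or>\<^sup>kA|\<^sup>p\<close> on the symmetric tensors, so its
  trace is \<open>h\<^sub>k(w)\<close>.  The integrand is \<open>(\<Sum>\<^sub>j w\<^sub>j |\<xi>\<^sub>j|\<^sup>2)\<^sup>k\<close> in the coordinates of \<open>e\<close>; it is homogeneous,
  so its mean over the sphere is the quotient of its Gaussian integral by that of \<open>|x|\<^sup>2\<^sup>k\<close>.  The
  Gaussian measure is a product of measures under which \<open>|x\<^sub>j|\<^sup>2\<close> is exponentially distributed, whence
  the Gaussian integral is \<open>\<pi>\<^sup>n k! h\<^sub>k(w)\<close>, and \<open>h\<^sub>k(1, \<dots>, 1)\<close> is the number of multisets.
\<close>

section \<open>Lebesgue measure and Gaussian integrals\<close>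

lemma nn_integral_lborel_translate:
  fixes f :: "'a::euclidean_space \<Rightarrow> ennreal"
  assumes [measurable]: "f \<in> borel_measurable borel"
  shows "(\<integral>\<^sup>+x. f (t + x) \<partial>lborel) = (\<integral>\<^sup>+x. f x \<partial>lborel)"
  by (subst (2) lborel_distr_plus[symmetric, of t]) (simp add: nn_integral_distr)

lemma nn_integral_lborel_scale:
  fixes f :: "'a::euclidean_space \<Rightarrow> ennreal"
  assumes [measurable]: "f \<in> borel_measurable borel" and "0 < r"
  shows "(\<integral>\<^sup>+x. f x \<partial>lborel) = ennreal (r ^ DIM('a)) * (\<integral>\<^sup>+x. f (r *\<^sub>R x) \<partial>lborel)"
  using assms(2)
  by (subst lborel_affine[of r 0]) (simp_all add: nn_integral_density nn_integral_distr nn_integral_cmult)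

text \<open>
  As in the proof of uniqueness of Haar measure, translation invariance gives
  \<open>\<integral>g \<cdot> \<integral>f \<circ> U = \<integral>g \<cdot> \<integral>f\<close> when \<open>g\<close> is a radial function.
\<close>

lemma nn_integral_lborel_orthogonal:
  fixes f :: "'a::euclidean_space \<Rightarrow> ennreal" and U :: "'a \<Rightarrow> 'a"
  assumes [measurable]: "f \<in> borel_measurable borel" and U: "orthogonal_transformation U"
  shows "(\<integral>\<^sup>+x. f (U x) \<partial>lborel) = (\<integral>\<^sup>+x. f x \<partial>lborel)"
proof -
  let ?g = "indicator (cball 0 1) :: 'a \<Rightarrow> ennreal"
  have [measurable]: "cball (0::'a) 1 \<in> sets borel" by simp
  obtain V where V: "orthogonal_transformation V" "\<And>x. U (V x) = x" "\<And>x. V (U x) = x"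
    using orthogonal_transformation_inv[OF U] orthogonal_transformation_bij[OF U]
    by (metis bij_inv_eq_iff)
  have linU: "linear U" and linV: "linear V"
    using U V orthogonal_transformation_linear by auto
  have [measurable]: "U \<in> borel_measurable borel" "V \<in> borel_measurable borel"
    using linU linV by (auto intro!: borel_measurable_continuous_onI linear_continuous_on simp: linear_conv_bounded_linear)
  \<comment> \<open>As \<open>V\<close> inverts the isometry \<open>U\<close>, the dependence on
    \<open>x\<close> is a translation by \<open>- V y\<close>, so integrating over \<open>x\<close>
    gives the ball volume for every \<open>y\<close>.\<close>
  have gV: "?g (y - U x) = ?g (- V y + x)" for x y
  proof -
    have "norm (y - U x) = norm (U (V y - x))"
      using V linU by (simp add: linear_diff)
    also have "\<dots> = norm (- V y + x)"
      using U by (simp add: orthogonal_transformation norm_minus_commute)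
    finally show ?thesis by (simp add: indicator_def)
  qed
  have vol: "emeasure lborel (cball 0 1 :: 'a set) \<noteq> 0" "emeasure lborel (cball 0 1 :: 'a set) \<noteq> \<infinity>"
    using emeasure_cball_pos[where 'a='a] emeasure_compact_finite[of "cball 0 1 :: 'a set"] by auto
  have "(\<integral>\<^sup>+y. ?g y \<partial>lborel) * (\<integral>\<^sup>+x. f (U x) \<partial>lborel)
      = (\<integral>\<^sup>+y. ?g y * (\<integral>\<^sup>+x. f (U x) \<partial>lborel) \<partial>lborel)"
    by (rule nn_integral_multc[symmetric]) measurable
  \<comment> \<open>Shifting \<open>x\<close> by \<open>V y\<close> adds \<open>U (V y) = y\<close>
    to the argument of \<open>f\<close>.\<close>
  also have "\<dots> = (\<integral>\<^sup>+y. ?g y * (\<integral>\<^sup>+x. f (y + U x) \<partial>lborel) \<partial>lborel)"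
  proof (rule nn_integral_cong)
    fix y :: 'a
    have "(\<integral>\<^sup>+x. f (U x) \<partial>lborel) = (\<integral>\<^sup>+x. f (U (V y + x)) \<partial>lborel)"
      by (rule nn_integral_lborel_translate[symmetric]) measurable
    then show "?g y * (\<integral>\<^sup>+x. f (U x) \<partial>lborel) = ?g y * (\<integral>\<^sup>+x. f (y + U x) \<partial>lborel)"
      using V linU by (simp add: linear_add)
  qed
  also have "\<dots> = (\<integral>\<^sup>+y. \<integral>\<^sup>+x. ?g y * f (y + U x) \<partial>lborel \<partial>lborel)"
    by (intro nn_integral_cong nn_integral_cmult[symmetric]) measurable
  also have "\<dots> = (\<integral>\<^sup>+x. \<integral>\<^sup>+y. ?g y * f (y + U x) \<partial>lborel \<partial>lborel)"
    by (rule lborel_pair.Fubini') measurable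
  \<comment> \<open>Shifting \<open>y\<close> by \<open>U x\<close> moves the dependence on
    \<open>x\<close> from \<open>f\<close> to the radial function.\<close>
  also have "\<dots> = (\<integral>\<^sup>+x. \<integral>\<^sup>+y. ?g (y - U x) * f y \<partial>lborel \<partial>lborel)"
  proof (rule nn_integral_cong)
    fix x :: 'a
    show "(\<integral>\<^sup>+y. ?g y * f (y + U x) \<partial>lborel) = (\<integral>\<^sup>+y. ?g (y - U x) * f y \<partial>lborel)"
      using nn_integral_lborel_translate[of "\<lambda>y. ?g (y - U x) * f y" "U x"]
      by (simp add: add.commute)
  qed
  also have "\<dots> = (\<integral>\<^sup>+y. \<integral>\<^sup>+x. ?g (y - U x) * f y \<partial>lborel \<partial>lborel)"
    by (rule lborel_pair.Fubini') measurable
  also have "\<dots> = (\<integral>\<^sup>+y. (\<integral>\<^sup>+x. ?g (- V y + x) \<partial>lborel) * f y \<partial>lborel)"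
    by (intro nn_integral_cong, simp only: gV) (rule nn_integral_multc, measurable)
  also have "\<dots> = (\<integral>\<^sup>+y. (\<integral>\<^sup>+x. ?g x \<partial>lborel) * f y \<partial>lborel)"
    by (subst nn_integral_lborel_translate) auto
  also have "\<dots> = (\<integral>\<^sup>+y. ?g y \<partial>lborel) * (\<integral>\<^sup>+x. f x \<partial>lborel)"
    by (rule nn_integral_cmult) simp
  finally show ?thesis
    using vol by (simp add: ennreal_mult_cancel_left)
qed

text \<open>Closed rays are stable under intersection and generate the Borel sets, and those ending
  at natural numbers exhaust the line. Distributions of norms are thereby compared through volumes
  of balls.\<close>

lemma measure_eqI_atMost:
  fixes M N :: "real measure"
  assumes "sets M = sets borel" "sets N = sets borel"
    and "\<And>a. emeasure M {..a} = emeasure N {..a}" "\<And>a. emeasure M {..a} \<noteq> \<infinity>"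
  shows "M = N"
proof (rule measure_eqI_generator_eq[where E = "range atMost" and \<Omega> = UNIV and A = "\<lambda>n. {..real n}"])
  show "Int_stable (range (atMost :: real \<Rightarrow> _))"
    unfolding Int_stable_def
  proof safe
    fix a b :: real
    have "{..a} \<inter> {..b} = {..min a b}" by auto
    then show "{..a} \<inter> {..b} \<in> range atMost" by auto
  qed
  have "sets (borel :: real measure) = sigma_sets UNIV (range atMost)"
    by (subst borel_eq_atMost) simp
  then show "sets M = sigma_sets UNIV (range atMost)" "sets N = sigma_sets UNIV (range atMost)"
    using assms by auto
  show "(\<Union>i. {..real i}) = UNIV"
    using real_arch_simple by auto
qed (use assms in auto)

text \<open>
  Integration in polar coordinates: under the density \<open>h\<close>, the distribution of the norm is
  proportional to that under Lebesgue measure.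
\<close>

lemma nn_integral_homogeneous_radial:
  fixes h :: "'a::euclidean_space \<Rightarrow> ennreal"
  assumes [measurable]: "h \<in> borel_measurable borel" "\<phi> \<in> borel_measurable borel"
    and hom: "\<And>r x. 0 < r \<Longrightarrow> h (r *\<^sub>R x) = h x"
    and fin: "(\<integral>\<^sup>+x. h x * indicator (cball 0 1) x \<partial>lborel) \<noteq> \<infinity>"
  shows "(\<integral>\<^sup>+x. h x * indicator (cball 0 1) x \<partial>lborel) * (\<integral>\<^sup>+x. \<phi> (norm (x::'a)) \<partial>lborel) =
    emeasure lborel (cball 0 1 :: 'a set) * (\<integral>\<^sup>+x. h x * \<phi> (norm x) \<partial>lborel)"
proof -
  let ?a = "\<integral>\<^sup>+x. h x * indicator (cball 0 1) x \<partial>lborel"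
  let ?v = "emeasure lborel (cball 0 1 :: 'a set)"
  have [measurable]: "cball (0::'a) r \<in> sets borel" for r by simp
  have vfin: "?v \<noteq> \<infinity>"
    using emeasure_compact_finite[of "cball 0 1 :: 'a set"] by auto
  have ball: "(\<integral>\<^sup>+x. g x * indicator (cball 0 r) x \<partial>lborel) =
      (if 0 \<le> r then ennreal (r ^ DIM('a)) * (\<integral>\<^sup>+x. g x * indicator (cball 0 1) x \<partial>lborel) else 0)"
    if [measurable]: "g \<in> borel_measurable borel" and g: "\<And>r x. 0 < r \<Longrightarrow> g (r *\<^sub>R x) = g x"
    for g :: "'a \<Rightarrow> ennreal" and r
  proof -
    consider "r < 0" | "r = 0" | "0 < r" by linarith
    then show ?thesis
    proof cases
      case 1
      then show ?thesis by simp
    next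
      case 2
      \<comment> \<open>Homogeneity leaves the value of \<open>g\<close> at the origin free, but a
        point is a null set.\<close>
      have "AE x :: 'a in lborel. g x * indicator (cball 0 0) x = 0"
        using AE_lborel_singleton[of "0::'a"] by eventually_elim (auto simp: indicator_def)
      then have "(\<integral>\<^sup>+x. g x * indicator (cball 0 0) x \<partial>lborel) = 0"
        by (simp add: nn_integral_0_iff_AE)
      then show ?thesis using 2 by (simp add: power_0_left)
    next
      case 3
      have "(indicator (cball 0 r) (r *\<^sub>R x) :: ennreal) = indicator (cball 0 1) x" for x :: 'a
        using 3 by (simp add: indicator_def)
      moreover have "(\<lambda>x. g x * indicator (cball 0 r) x) \<in> borel_measurable borel"
        by measurable
      ultimately show ?thesis
        using 3 g nn_integral_lborel_scale[of "\<lambda>x. g x * indicator (cball 0 r) x", OF _ 3] by simp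
    qed
  qed
  \<comment> \<open>Each distribution of the norm is multiplied by the mass that the other one gives
    to the unit ball. Cross-multiplication avoids a division by \<open>?a\<close>, which may be
    zero.\<close>
  define M where "M = density (distr (density lborel h) borel norm) (\<lambda>_. ?v)"
  define N where "N = density (distr lborel borel (norm :: 'a \<Rightarrow> real)) (\<lambda>_. ?a)"
  have pre: "norm -` {..r} = (cball 0 r :: 'a set)" for r
    by auto
  have "M = N"
  proof (rule measure_eqI_atMost)
    fix r :: real
    have M: "emeasure M {..r} = ?v * (\<integral>\<^sup>+x. h x * indicator (cball 0 r) x \<partial>lborel)"
      by (simp add: M_def emeasure_density nn_integral_cmult_indicator emeasure_distr pre)
    have N: "emeasure N {..r} = ?a * (\<integral>\<^sup>+x. 1 * indicator (cball (0::'a) r) x \<partial>lborel)"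
      by (simp add: N_def emeasure_density nn_integral_cmult_indicator emeasure_distr pre)
    show "emeasure M {..r} = emeasure N {..r}"
      unfolding M N by (subst (1 2) ball) (auto simp: hom mult_ac)
    show "emeasure M {..r} \<noteq> \<infinity>"
      unfolding M using fin vfin by (subst ball) (auto simp: hom ennreal_mult_eq_top_iff)
  qed (auto simp: M_def N_def)
  then have "(\<integral>\<^sup>+t. \<phi> t \<partial>M) = (\<integral>\<^sup>+t. \<phi> t \<partial>N)" by simp
  moreover have "(\<integral>\<^sup>+t. \<phi> t \<partial>M) = ?v * (\<integral>\<^sup>+x. h x * \<phi> (norm x) \<partial>lborel)"
    by (simp add: M_def nn_integral_density nn_integral_cmult nn_integral_distr)
  moreover have "(\<integral>\<^sup>+t. \<phi> t \<partial>N) = ?a * (\<integral>\<^sup>+x. \<phi> (norm (x::'a)) \<partial>lborel)"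
    by (simp add: N_def nn_integral_density nn_integral_cmult nn_integral_distr)
  ultimately show ?thesis by simp
qed

text \<open>A disc of radius \<open>sqrt r\<close> has area \<open>pi * r\<close>, so the squared
  modulus carries Lebesgue measure of the plane to \<open>pi\<close> times Lebesgue measure of the
  half-line.\<close>

lemma nn_integral_complex_norm_square:
  assumes [measurable]: "\<phi> \<in> borel_measurable borel"
  shows "(\<integral>\<^sup>+z. \<phi> ((cmod z)\<^sup>2) \<partial>lborel) = ennreal pi * (\<integral>\<^sup>+t. \<phi> t * indicator {0..} t \<partial>lborel)"
proof -
  have "distr lborel borel (\<lambda>z. (cmod z)\<^sup>2) = density lborel (\<lambda>t. ennreal pi * indicator {0..} t)"
    (is "?M = ?N")
  proof (rule measure_eqI_atMost)
    fix r :: real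
    have "(\<lambda>z. (cmod z)\<^sup>2) -` {..r} = (if 0 \<le> r then cball 0 (sqrt r) else {})"
      by (auto simp: real_le_rsqrt intro: order_trans[OF zero_le_power2] dest: sqrt_ge_absD)
         (simp add: sqrt_ge_absD)
    then have "emeasure ?M {..r} = (if 0 \<le> r then ennreal (pi * r) else 0)"
      by (simp add: emeasure_distr emeasure_cball unit_ball_vol_2)
    moreover have "emeasure ?N {..r} = (if 0 \<le> r then ennreal (pi * r) else 0)"
    proof -
      have "emeasure ?N {..r} = (\<integral>\<^sup>+t. ennreal pi * indicator {0..r} t \<partial>lborel)"
        by (auto simp: emeasure_density indicator_def intro!: nn_integral_cong)
      also have "\<dots> = ennreal pi * ennreal (if 0 \<le> r then r else 0)"
        by (simp add: nn_integral_cmult_indicator emeasure_lborel_Icc_eq)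
      finally show ?thesis by (simp add: ennreal_mult)
    qed
    ultimately show "emeasure ?M {..r} = emeasure ?N {..r}" "emeasure ?M {..r} \<noteq> \<infinity>"
      by auto
  qed auto
  then have "(\<integral>\<^sup>+t. \<phi> t \<partial>?M) = (\<integral>\<^sup>+t. \<phi> t \<partial>?N)" by simp
  then show ?thesis
    by (simp add: nn_integral_distr nn_integral_density nn_integral_cmult mult_ac)
qed

lemma nn_integral_complex_gaussian_moment:
  "(\<integral>\<^sup>+z. ennreal ((cmod z)\<^sup>2 ^ m * exp (- (cmod z)\<^sup>2)) \<partial>lborel) = ennreal (pi * fact m)"
proof -
  have "(\<integral>\<^sup>+z. ennreal ((cmod z)\<^sup>2 ^ m * exp (- (cmod z)\<^sup>2)) \<partial>lborel) =
      ennreal pi * (\<integral>\<^sup>+t. ennreal (t ^ m * exp (- t)) * indicator {0..} t \<partial>lborel)"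
    by (rule nn_integral_complex_norm_square) measurable
  \<comment> \<open>\<open>erlang_density 0 1\<close> is the exponential density of rate 1, whose
    moments are the factorials.\<close>
  also have "(\<integral>\<^sup>+t. ennreal (t ^ m * exp (- t)) * indicator {0..} t \<partial>lborel) =
      (\<integral>\<^sup>+t. ennreal (erlang_density 0 1 t * t ^ m) \<partial>lborel)"
    by (intro nn_integral_cong) (auto simp: erlang_density_def indicator_def mult_ac)
  also have "\<dots> = ennreal (fact m)"
    by (subst nn_integral_erlang_ith_moment) simp_all
  finally show ?thesis by (simp add: ennreal_mult)
qed

section \<open>Lebesgue measure on vectors as a product measure\<close>

lemma measurable_vec_lambda:
  "vec_lambda \<in> (\<Pi>\<^sub>M j\<in>(UNIV::'n::finite set). (lborel::'a::euclidean_space measure)) \<rightarrow>\<^sub>M borel"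
proof (subst borel_measurable_euclidean_space, safe)
  fix b :: "'a ^ 'n" assume "b \<in> Basis"
  then obtain j c where "b = axis j c" by (auto simp: Basis_vec_def)
  then show "(\<lambda>x. vec_lambda x \<bullet> b) \<in> borel_measurable (\<Pi>\<^sub>M j\<in>UNIV. lborel)"
    by (simp add: inner_axis)
qed

lemma measurable_vec_nth:
  "(\<lambda>x. x $ j) \<in> borel_measurable (borel :: ('a::euclidean_space ^ 'n::finite) measure)"
  by (intro borel_measurable_continuous_onI continuous_intros)

text \<open>Lebesgue measure is determined by its values on boxes, and a box of vectors is the
  product of its coordinate boxes. Integrals of products over the coordinates then factor.\<close>

lemma lborel_vec_eq:
  "(lborel :: ('a::euclidean_space ^ 'n::finite) measure) =
    distr (\<Pi>\<^sub>M j\<in>UNIV. lborel) borel vec_lambda"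
proof (rule lborel_eqI)
  interpret product_sigma_finite "\<lambda>_::'n. lborel :: 'a measure" ..
  note measurable_vec_lambda[measurable]
  fix l u :: "'a ^ 'n"
  assume le: "\<And>b. b \<in> Basis \<Longrightarrow> l \<bullet> b \<le> u \<bullet> b"
  have le': "l $ j \<bullet> b \<le> u $ j \<bullet> b" if "b \<in> Basis" for j b
  proof -
    have "axis j b \<in> Basis" using that by (auto simp: Basis_vec_def)
    from le[OF this] show ?thesis by (simp add: inner_axis)
  qed
  show "emeasure (distr (\<Pi>\<^sub>M j\<in>UNIV. lborel) borel vec_lambda) (box l u) = (\<Prod>b\<in>Basis. (u - l) \<bullet> b)"
  proof -
    have "vec_lambda -` box l u = (\<Pi>\<^sub>E j\<in>UNIV. box (l $ j) (u $ j))"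
      by (auto simp: mem_box Basis_vec_def inner_axis PiE_iff)
    then have "emeasure (distr (\<Pi>\<^sub>M j\<in>UNIV. lborel) borel vec_lambda) (box l u) =
        emeasure (\<Pi>\<^sub>M j\<in>UNIV. lborel) (\<Pi>\<^sub>E j\<in>UNIV. box (l $ j) (u $ j))"
      by (simp add: emeasure_distr space_PiM)
    also have "\<dots> = (\<Prod>j\<in>UNIV. emeasure lborel (box (l $ j) (u $ j)))"
      by (rule emeasure_PiM) auto
    also have "\<dots> = ennreal (\<Prod>j\<in>UNIV. \<Prod>b\<in>Basis. (u $ j - l $ j) \<bullet> b)"
      using le' by (simp add: emeasure_lborel_box prod_ennreal prod_nonneg inner_diff_left)
    also have "(\<Prod>j\<in>UNIV. \<Prod>b\<in>Basis. (u $ j - l $ j) \<bullet> b) = (\<Prod>b\<in>Basis. (u - l) \<bullet> b)"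
    proof -
      have "bij_betw (\<lambda>p. axis (fst p) (snd p)) (UNIV \<times> Basis) (Basis :: ('a ^ 'n) set)"
        by (auto simp: bij_betw_def inj_on_def axis_eq_axis Basis_vec_def nonzero_Basis image_iff)
      from prod.reindex_bij_betw[OF this, of "\<lambda>b. (u - l) \<bullet> b"] show ?thesis
        by (simp add: prod.cartesian_product case_prod_unfold inner_axis)
    qed
    finally show ?thesis .
  qed
qed simp

section \<open>Index functions and the multisets of their values\<close>

definition mset_of_fun :: "('k::finite \<Rightarrow> 'n) \<Rightarrow> 'n multiset" where
  "mset_of_fun f = image_mset f (mset_set UNIV)"

lemma mset_of_fun_in:
  fixes f :: "'k::finite \<Rightarrow> 'n"
  shows "mset_of_fun f \<in> multisets_of_size UNIV CARD('k)"
  by (simp add: mset_of_fun_def multisets_of_size_def)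

lemma prod_mset_of_fun:
  fixes f :: "'k::finite \<Rightarrow> 'n::finite" and y :: "'n \<Rightarrow> 'a::comm_monoid_mult"
  shows "(\<Prod>i\<in>UNIV. y (f i)) = (\<Prod>j\<in>#mset_of_fun f. y j)"
  by (simp add: mset_of_fun_def prod_unfold_prod_mset image_mset.compositionality comp_def)

lemma prod_mset_power_count:
  fixes y :: "'n::finite \<Rightarrow> 'a::comm_monoid_mult"
  shows "(\<Prod>j\<in>#M. y j) = (\<Prod>j\<in>UNIV. y j ^ count M j)"
proof (induction M)
  case (add x M)
  have "(\<Prod>j\<in>UNIV. y j ^ count (add_mset x M) j) = (\<Prod>j\<in>UNIV. y j ^ count M j * (if j = x then y j else 1))"
    by (intro prod.cong) (auto simp: mult.commute)
  then show ?case using add by (simp add: prod.distrib mult.commute)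
qed simp

text \<open>An enumeration \<open>xs\<close> of \<open>'k\<close> turns index functions into lists,
  and those with values \<open>M\<close> into the arrangements of \<open>M\<close>. The count is the
  multinomial coefficient, written without division.\<close>

lemma card_mset_of_fun:
  fixes M :: "'n::finite multiset"
  assumes "size M = CARD('k::finite)"
  shows "card {f :: 'k \<Rightarrow> 'n. mset_of_fun f = M} * (\<Prod>j\<in>UNIV. fact (count M j)) = fact CARD('k)"
proof -
  obtain xs :: "'k list" where xs: "set xs = UNIV" "distinct xs"
    using finite_distinct_list[of "UNIV :: 'k set"] by auto
  have len: "length xs = CARD('k)"
    using xs distinct_card by metis
  have mset: "mset (map f xs) = mset_of_fun f" for f :: "'k \<Rightarrow> 'n"
    using mset_set_set[OF xs(2)] xs(1) by (simp add: mset_of_fun_def)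
  have "bij_betw (\<lambda>f. map f xs) {f. mset_of_fun f = M} (permutations_of_multiset M)"
  proof (rule bij_betw_imageI)
    show "inj_on (\<lambda>f. map f xs) {f. mset_of_fun f = M}"
      using xs by (auto simp: inj_on_def)
    show "(\<lambda>f. map f xs) ` {f. mset_of_fun f = M} = permutations_of_multiset M"
    proof (intro equalityI subsetI)
      fix ys assume "ys \<in> permutations_of_multiset M"
      then have ys: "mset ys = M" by (simp add: permutations_of_multiset_def)
      then have lys: "length ys = length xs" using assms len by (metis size_mset)
      \<comment> \<open>The function reads off the entry of \<open>ys\<close> at the position of its
        argument in \<open>xs\<close>; distinctness of \<open>xs\<close> makes the lookup
        unambiguous.\<close>
      have "map (the \<circ> map_of (zip xs ys)) xs = ys"
        using lys xs(2) by (intro nth_equalityI) (auto simp: map_of_zip_nth)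
      then show "ys \<in> (\<lambda>f. map f xs) ` {f. mset_of_fun f = M}"
        using ys mset by (metis (mono_tags, lifting) imageI mem_Collect_eq)
    qed (auto simp: permutations_of_multiset_def mset simp del: mset_map)
  qed
  then have "card {f :: 'k \<Rightarrow> 'n. mset_of_fun f = M} = card (permutations_of_multiset M)"
    by (rule bij_betw_same_card)
  moreover have "(\<Prod>j\<in>UNIV. fact (count M j)) = (\<Prod>j\<in>set_mset M. fact (count M j) :: nat)"
    by (rule prod.mono_neutral_right) (auto simp: not_in_iff)
  ultimately show ?thesis
    using card_permutations_of_multiset_aux[of M] assms by simp
qed

text \<open>The multinomial theorem before equal monomials are collected: distributivity yields one
  term for each choice of a summand at every position.\<close>

lemma sum_power_eq_sum_mset_of_fun:
  fixes a :: "'n::finite \<Rightarrow> 'a::comm_semiring_1"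
  shows "(\<Sum>j\<in>UNIV. a j) ^ CARD('k) =
    (\<Sum>f\<in>(UNIV :: ('k::finite \<Rightarrow> 'n) set). \<Prod>j\<in>#mset_of_fun f. a j)"
proof -
  have "(\<Prod>i\<in>(UNIV :: 'k set). \<Sum>j\<in>UNIV. a j) = (\<Sum>f \<in> (\<Pi>\<^sub>E i\<in>UNIV. UNIV). \<Prod>i\<in>(UNIV :: 'k set). a (f i))"
    using prod_sum_PiE[of "UNIV :: 'k set" "\<lambda>_. UNIV" "\<lambda>_ j. a j"] by simp
  then show ?thesis by (simp add: prod_mset_of_fun)
qed

section \<open>Gaussian integrals of monomials and diagonal forms\<close>

lemma nn_integral_gaussian_monomial:
  fixes m :: "'n::finite \<Rightarrow> nat"
  shows "(\<integral>\<^sup>+x. ennreal ((\<Prod>j\<in>UNIV. (cmod (x $ j))\<^sup>2 ^ m j) * exp (- (norm x)\<^sup>2)) \<partial>lborel) =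
    ennreal (pi ^ CARD('n) * (\<Prod>j\<in>UNIV. fact (m j)))"
proof -
  interpret product_sigma_finite "\<lambda>_::'n. lborel :: complex measure" ..
  let ?g = "\<lambda>j z. ennreal ((cmod z)\<^sup>2 ^ m j * exp (- (cmod z)\<^sup>2))"
  have *: "ennreal ((\<Prod>j\<in>UNIV. (cmod (x $ j))\<^sup>2 ^ m j) * exp (- (norm x)\<^sup>2)) = (\<Prod>j\<in>UNIV. ?g j (x $ j))"
    for x :: "complex ^ 'n"
  proof -
    \<comment> \<open>The squared norm is a sum over the coordinates, so the Gaussian factorises and
      the monomial splits into moments in one complex variable.\<close>
    have "exp (- (norm x)\<^sup>2) = (\<Prod>j\<in>UNIV. exp (- (cmod (x $ j))\<^sup>2))"
      by (simp add: norm_vec_def L2_set_def sum_nonneg exp_sum sum_negf[symmetric] del: sum_negf)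
    then show ?thesis
      by (simp add: prod_ennreal prod.distrib)
  qed
  have [measurable]: "vec_lambda \<in> (\<Pi>\<^sub>M j\<in>(UNIV::'n set). (lborel::complex measure)) \<rightarrow>\<^sub>M borel"
    by (rule measurable_vec_lambda)
  note measurable_vec_nth[measurable]
  have "(\<integral>\<^sup>+x. (\<Prod>j\<in>UNIV. ?g j (x $ j)) \<partial>lborel) =
      (\<integral>\<^sup>+y. (\<Prod>j\<in>UNIV. ?g j (y j)) \<partial>(\<Pi>\<^sub>M j\<in>UNIV. lborel))"
    by (subst lborel_vec_eq) (simp add: nn_integral_distr)
  also have "\<dots> = (\<Prod>j\<in>UNIV. \<integral>\<^sup>+z. ?g j z \<partial>lborel)"
    by (rule product_nn_integral_prod) auto
  also have "\<dots> = ennreal (pi ^ CARD('n) * (\<Prod>j\<in>UNIV. fact (m j)))"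
    by (simp only: nn_integral_complex_gaussian_moment) (simp add: prod_ennreal prod.distrib)
  finally show ?thesis by (simp only: *)
qed

text \<open>The right-hand side is the complete homogeneous symmetric polynomial of the weights.\<close>

lemma nn_integral_gaussian_diagonal_form:
  fixes w :: "'n::finite \<Rightarrow> real"
  assumes w: "\<And>j. 0 \<le> w j"
  shows "(\<integral>\<^sup>+x. ennreal ((\<Sum>j\<in>UNIV. w j * (cmod (x $ j))\<^sup>2) ^ CARD('k::finite) * exp (- (norm x)\<^sup>2)) \<partial>lborel) =
    ennreal (pi ^ CARD('n) * fact CARD('k) * (\<Sum>M\<in>multisets_of_size UNIV CARD('k). \<Prod>j\<in>#M. w j))"
proof -
  let ?X = "\<lambda>(x::complex ^ 'n) j. (cmod (x $ j))\<^sup>2"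
  let ?E = "\<lambda>x::complex ^ 'n. exp (- (norm x)\<^sup>2)"
  let ?c = "pi ^ CARD('n)"
  note measurable_vec_nth[measurable]
  have pw: "0 \<le> (\<Prod>j\<in>#M. w j)" for M
    by (simp add: prod_mset_power_count prod_nonneg w)
  have mono: "(\<integral>\<^sup>+x. ennreal ((\<Prod>j\<in>#M. w j * ?X x j) * ?E x) \<partial>lborel) =
      ennreal (?c * ((\<Prod>j\<in>#M. w j) * (\<Prod>j\<in>UNIV. fact (count M j))))" for M
  proof -
    have "(\<integral>\<^sup>+x. ennreal ((\<Prod>j\<in>#M. w j * ?X x j) * ?E x) \<partial>lborel) =
        (\<integral>\<^sup>+x. ennreal (\<Prod>j\<in>#M. w j) * ennreal ((\<Prod>j\<in>UNIV. ?X x j ^ count M j) * ?E x) \<partial>lborel)"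
      by (simp add: prod_mset_power_count power_mult_distrib prod.distrib ennreal_mult[symmetric]
          prod_nonneg w mult_ac)
    also have "\<dots> = ennreal (\<Prod>j\<in>#M. w j) * ennreal (?c * (\<Prod>j\<in>UNIV. fact (count M j)))"
      by (subst nn_integral_cmult) (simp_all only: nn_integral_gaussian_monomial, measurable)
    finally show ?thesis
      using pw by (simp add: ennreal_mult[symmetric] prod_nonneg mult_ac)
  qed
  have "(\<integral>\<^sup>+x. ennreal ((\<Sum>j\<in>UNIV. w j * ?X x j) ^ CARD('k) * ?E x) \<partial>lborel) =
      (\<integral>\<^sup>+x. (\<Sum>f\<in>(UNIV :: ('k \<Rightarrow> 'n) set). ennreal ((\<Prod>j\<in>#mset_of_fun f. w j * ?X x j) * ?E x)) \<partial>lborel)"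
    by (intro nn_integral_cong)
      (simp add: sum_power_eq_sum_mset_of_fun sum_distrib_right sum_ennreal prod_mset_power_count prod_nonneg w)
  also have "\<dots> = (\<Sum>f\<in>(UNIV :: ('k \<Rightarrow> 'n) set).
      ennreal (?c * ((\<Prod>j\<in>#mset_of_fun f. w j) * (\<Prod>j\<in>UNIV. fact (count (mset_of_fun f) j)))))"
    by (subst nn_integral_sum) (simp only: mono | simp add: prod_mset_power_count)+
  also have "\<dots> = ennreal (\<Sum>f\<in>(UNIV :: ('k \<Rightarrow> 'n) set).
      ?c * ((\<Prod>j\<in>#mset_of_fun f. w j) * (\<Prod>j\<in>UNIV. fact (count (mset_of_fun f) j))))"
    using pw by (intro sum_ennreal) (simp add: prod_nonneg)
  also have "(\<Sum>f\<in>(UNIV :: ('k \<Rightarrow> 'n) set).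
        ?c * ((\<Prod>j\<in>#mset_of_fun f. w j) * (\<Prod>j\<in>UNIV. fact (count (mset_of_fun f) j)))) =
      (\<Sum>M\<in>multisets_of_size UNIV CARD('k). \<Sum>f\<in>{f :: 'k \<Rightarrow> 'n. mset_of_fun f = M}.
        ?c * ((\<Prod>j\<in>#mset_of_fun f. w j) * (\<Prod>j\<in>UNIV. fact (count (mset_of_fun f) j))))"
    by (subst sum.group[where S = "UNIV :: ('k \<Rightarrow> 'n) set" and g = mset_of_fun
        and T = "multisets_of_size UNIV CARD('k)", symmetric])
      (simp_all add: mset_of_fun_in image_subset_iff finite_multisets_of_size)
  \<comment> \<open>The factorials from the Gaussian moments are the denominators of the multinomial
    coefficient. Their cancellation gives every multiset the same weight
    \<open>fact CARD('k)\<close>.\<close>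
  also have "\<dots> = (\<Sum>M\<in>multisets_of_size UNIV CARD('k). ?c * fact CARD('k) * (\<Prod>j\<in>#M. w j))"
  proof (rule sum.cong)
    fix M :: "'n multiset"
    assume "M \<in> multisets_of_size UNIV CARD('k)"
    then have "real (card {f :: 'k \<Rightarrow> 'n. mset_of_fun f = M}) * (\<Prod>j\<in>UNIV. fact (count M j)) = fact CARD('k)"
      using arg_cong[OF card_mset_of_fun[of M, where 'k='k], of real]
      by (simp add: multisets_of_size_def)
    then show "(\<Sum>f\<in>{f :: 'k \<Rightarrow> 'n. mset_of_fun f = M}.
        ?c * ((\<Prod>j\<in>#mset_of_fun f. w j) * (\<Prod>j\<in>UNIV. fact (count (mset_of_fun f) j)))) =
        ?c * fact CARD('k) * (\<Prod>j\<in>#M. w j)"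
      by (simp flip: \<open>_ = fact CARD('k)\<close>)
  qed simp
  finally show ?thesis by (simp add: sum_distrib_left)
qed

section \<open>Functional calculus in an eigenbasis\<close>

lemma hinner_add_left: "hinner (x + y) z = hinner x z + hinner y z"
  and hinner_add_right: "hinner x (y + z) = hinner x y + hinner x z"
  and hinner_diff_left: "hinner (x - y) z = hinner x z - hinner y z"
  and hinner_diff_right: "hinner x (y - z) = hinner x y - hinner x z"
  and hinner_scale_left: "hinner (c *s x) z = c * hinner x z"
  and hinner_scale_right: "hinner x (c *s z) = cnj c * hinner x z"
  and hinner_zero_left: "hinner 0 z = 0"
  and hinner_zero_right: "hinner z 0 = 0"
  by (simp_all add: hinner_def algebra_simps sum.distrib sum_subtractf sum_distrib_left)

lemma hinner_sum_left: "hinner (\<Sum>i\<in>I. f i) z = (\<Sum>i\<in>I. hinner (f i) z)"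
  by (induction I rule: infinite_finite_induct) (simp_all add: hinner_add_left hinner_zero_left)

lemma hinner_sum_right: "hinner z (\<Sum>i\<in>I. f i) = (\<Sum>i\<in>I. hinner z (f i))"
  by (induction I rule: infinite_finite_induct) (simp_all add: hinner_add_right hinner_zero_right)

lemmas hinner_linear = hinner_add_left hinner_add_right hinner_diff_left hinner_diff_right
  hinner_scale_left hinner_scale_right hinner_zero_left hinner_zero_right
  hinner_sum_left hinner_sum_right

lemma cnj_hinner: "cnj (hinner x y) = hinner y x"
  by (simp add: hinner_def mult.commute)

lemma hinner_self: "hinner x x = of_real ((norm x)\<^sup>2)"
  by (simp add: hinner_def norm_vec_def L2_set_def sum_nonneg complex_norm_square del: of_real_power)

lemma hinner_self_eq_0_iff: "hinner x x = 0 \<longleftrightarrow> x = 0"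
  by (simp add: hinner_self)

text \<open>Completeness is expressed as the Fourier expansion. Indexing the basis attaches
  eigenvalues to indices, which are coordinates in one application and multisets in another.\<close>

locale orthonormal_family =
  fixes I :: "'i set" and e :: "'i \<Rightarrow> complex ^ 'a::finite" and V :: "(complex ^ 'a) set"
  assumes finite_I: "finite I" and subspace: "vec.subspace V"
    and e_in: "i \<in> I \<Longrightarrow> e i \<in> V"
    and ortho: "i \<in> I \<Longrightarrow> j \<in> I \<Longrightarrow> hinner (e i) (e j) = (if i = j then 1 else 0)"
    and expansion: "x \<in> V \<Longrightarrow> x = (\<Sum>i\<in>I. hinner x (e i) *s e i)"
begin

lemma hinner_sum_coeff:
  assumes "j \<in> I" "J \<subseteq> I"
  shows "hinner (\<Sum>i\<in>J. c i *s e i) (e j) = (if j \<in> J then c j else 0)"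
proof -
  have "hinner (\<Sum>i\<in>J. c i *s e i) (e j) = (\<Sum>i\<in>J. if j = i then c i else 0)"
    using assms by (auto simp: hinner_linear ortho subset_iff intro!: sum.cong)
  then show ?thesis
    using assms finite_I by (simp add: finite_subset)
qed

lemma sum_in: "J \<subseteq> I \<Longrightarrow> (\<Sum>i\<in>J. c i *s e i) \<in> V"
  using subspace e_in by (intro vec.subspace_sum vec.subspace_scale) auto

lemma parseval:
  assumes "x \<in> V"
  shows "hinner x y = (\<Sum>i\<in>I. hinner x (e i) * cnj (hinner y (e i)))"
  by (subst expansion[OF assms]) (simp add: hinner_linear cnj_hinner)

section \<open>Operators diagonal in the orthonormal family\<close>

context
  fixes T :: "complex ^ 'a \<Rightarrow> complex ^ 'a" and l :: "'i \<Rightarrow> real"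
  assumes T: "\<And>x. x \<in> V \<Longrightarrow> T x = (\<Sum>i\<in>I. (of_real (l i) * hinner x (e i)) *s e i)"
begin

text \<open>Compare coefficients of \<open>T x\<close> and \<open>of_real m *s x\<close>. The
  function \<open>l\<close> may repeat values, which accounts for eigenspaces of higher
  dimension.\<close>

lemma eigenspace_diagonal:
  "eigenspace_on V T (of_real m) = {x \<in> V. \<forall>i\<in>I. l i \<noteq> m \<longrightarrow> hinner x (e i) = 0}"
proof (intro equalityI subsetI)
  fix x assume "x \<in> eigenspace_on V T (of_real m)"
  then have x: "x \<in> V" "T x = of_real m *s x" by (auto simp: eigenspace_on_def)
  have "hinner x (e i) = 0" if i: "i \<in> I" "l i \<noteq> m" for i
  proof -
    have "of_real (l i) * hinner x (e i) = hinner (T x) (e i)"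
      using i x(1) by (simp add: T hinner_sum_coeff)
    also have "\<dots> = of_real m * hinner x (e i)"
      by (simp add: x hinner_linear)
    finally show ?thesis using i by simp
  qed
  then show "x \<in> {x \<in> V. \<forall>i\<in>I. l i \<noteq> m \<longrightarrow> hinner x (e i) = 0}"
    using x by auto
next
  fix x assume "x \<in> {x \<in> V. \<forall>i\<in>I. l i \<noteq> m \<longrightarrow> hinner x (e i) = 0}"
  then have x: "x \<in> V" "\<And>i. i \<in> I \<Longrightarrow> l i \<noteq> m \<Longrightarrow> hinner x (e i) = 0" by auto
  have "T x = (\<Sum>i\<in>I. of_real m *s (hinner x (e i) *s e i))"
    unfolding T[OF x(1)]
  proof (rule sum.cong)
    fix i assume "i \<in> I"
    then show "(of_real (l i) * hinner x (e i)) *s e i = of_real m *s (hinner x (e i) *s e i)"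
      using x(2) by (cases "l i = m") auto
  qed simp
  also have "\<dots> = of_real m *s x"
    by (subst (2) expansion[OF x(1)]) (rule vec.scale_sum_right[symmetric])
  finally show "x \<in> eigenspace_on V T (of_real m)"
    using x by (simp add: eigenspace_on_def)
qed

lemma eigenvalues_diagonal: "of_real m \<in> eigenvalues_on V T \<longleftrightarrow> m \<in> l ` I"
proof
  assume "of_real m \<in> eigenvalues_on V T"
  then obtain x where x: "x \<in> V" "x \<noteq> 0" "\<And>i. i \<in> I \<Longrightarrow> l i \<noteq> m \<Longrightarrow> hinner x (e i) = 0"
    by (auto simp: eigenvalues_on_def eigenspace_diagonal)
  show "m \<in> l ` I"
  proof (rule ccontr)
    assume "m \<notin> l ` I"
    then have "\<forall>i\<in>I. hinner x (e i) = 0" using x by blast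
    then have "x = 0" by (subst expansion[OF x(1)]) simp
    then show False using x by simp
  qed
next
  assume "m \<in> l ` I"
  then obtain i where "i \<in> I" "m = l i" by auto
  moreover from this have "e i \<noteq> 0"
    using ortho[of i i] by (auto simp: hinner_linear)
  ultimately show "of_real m \<in> eigenvalues_on V T"
    by (auto intro!: exI[of _ "e i"] simp: eigenvalues_on_def eigenspace_diagonal e_in ortho)
qed

lemma orth_proj_eigenspace_diagonal:
  assumes "x \<in> V"
  shows "orth_proj (eigenspace_on V T (of_real m)) x = (\<Sum>i\<in>{i \<in> I. l i = m}. hinner x (e i) *s e i)"
    (is "_ = ?y")
  unfolding orth_proj_def
proof (rule the_equality)
  let ?E = "eigenspace_on V T (of_real m)"
  have y: "?y \<in> V" by (rule sum_in) auto
  have co: "hinner ?y (e i) = (if l i = m then hinner x (e i) else 0)" if "i \<in> I" for i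
    using that by (subst hinner_sum_coeff) auto
  have yE: "?y \<in> ?E"
    using y co by (auto simp: eigenspace_diagonal)
  have orth: "hinner (x - ?y) z = 0" if "z \<in> ?E" for z
  proof -
    have "x - ?y \<in> V" using subspace assms y by (rule vec.subspace_diff)
    then show ?thesis
      using that co by (subst parseval) (auto simp: eigenspace_diagonal hinner_diff_left intro!: sum.neutral)
  qed
  show "?y \<in> ?E \<and> (\<forall>z\<in>?E. hinner (x - ?y) z = 0)"
    using yE orth by auto
  \<comment> \<open>Both residuals are orthogonal to the eigenspace, which contains
    \<open>z - ?y\<close>; hence \<open>z - ?y\<close> is orthogonal to itself.\<close>
  fix z assume z: "z \<in> ?E \<and> (\<forall>w\<in>?E. hinner (x - z) w = 0)"
  have "vec.subspace ?E"
    using subspace by (auto simp: eigenspace_diagonal vec.subspace_def hinner_linear)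
  then have "z - ?y \<in> ?E" using z yE by (auto intro: vec.subspace_diff)
  then have "hinner (x - ?y) (z - ?y) = 0" "hinner (x - z) (z - ?y) = 0"
    using z orth by auto
  then have "hinner (z - ?y) (z - ?y) = 0"
    by (simp add: hinner_diff_left)
  then show "z = ?y" by (simp add: hinner_self_eq_0_iff)
qed

text \<open>\<open>op_powr\<close> sums over distinct eigenvalues. Expanding each projection and
  merging the fibres of \<open>l\<close> restores one term per index, so multiplicities are
  counted.\<close>

lemma op_powr_diagonal:
  assumes "x \<in> V"
  shows "op_powr V T r x = (\<Sum>i\<in>I. (of_real (l i powr r) * hinner x (e i)) *s e i)"
proof -
  have "op_powr V T r x =
      (\<Sum>m\<in>l ` I. \<Sum>i\<in>{i \<in> I. l i = m}. of_real (m powr r) *s (hinner x (e i) *s e i))"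
    unfolding op_powr_def eigenvalues_diagonal
    using assms by (simp add: orth_proj_eigenspace_diagonal vec.scale_sum_right)
  also have "\<dots> = (\<Sum>m\<in>l ` I. \<Sum>i\<in>{i \<in> I. l i = m}. (of_real (l i powr r) * hinner x (e i)) *s e i)"
    by (intro sum.cong) auto
  also have "\<dots> = (\<Sum>i\<in>I. (of_real (l i powr r) * hinner x (e i)) *s e i)"
    using finite_I by (rule sum.image_gen[symmetric])
  finally show ?thesis .
qed

end

end

section \<open>Orthonormal bases, traces and adjoints\<close>

lemma independent_orthonormal:
  fixes S :: "(complex ^ 'a::finite) set"
  assumes "\<And>b c. b \<in> S \<Longrightarrow> c \<in> S \<Longrightarrow> hinner b c = (if b = c then 1 else 0)"
  shows "vec.independent S"
proof
  assume "vec.dependent S"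
  then obtain F u v where F: "finite F" "F \<subseteq> S" "v \<in> F" "u v \<noteq> 0" "(\<Sum>v\<in>F. u v *s v) = 0"
    unfolding vec.dependent_explicit by auto
  have "0 = hinner (\<Sum>b\<in>F. u b *s b) v" using F by (simp add: hinner_zero_left)
  also have "\<dots> = (\<Sum>b\<in>F. if v = b then u b else 0)"
    unfolding hinner_sum_left hinner_scale_left using F(1-3) by (intro sum.cong) (auto simp: assms subset_iff)
  also have "\<dots> = u v" using F by simp
  finally show False using F by simp
qed

text \<open>Coefficients of a vector in the span are recovered by pairing with the basis. This
  serves for the basis picked by \<open>SOME\<close> in \<open>trace_on\<close>, of which only
  \<open>orthonormal_basis_of\<close> is known.\<close>

lemma orthonormal_family_of_basis:
  assumes "orthonormal_basis_of V B"
  shows "orthonormal_family B (\<lambda>b. b) V"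
proof
  have B: "vec.span B = V" "\<And>b c. b \<in> B \<Longrightarrow> c \<in> B \<Longrightarrow> hinner b c = (if b = c then 1 else 0)"
    using assms by (auto simp: orthonormal_basis_of_def)
  show fin: "finite B"
    using independent_orthonormal[OF B(2)] by (rule vec.finiteI_independent)
  show "vec.subspace V" using B vec.subspace_span by auto
  show "b \<in> V" if "b \<in> B" for b using that B vec.span_base by auto
  show "hinner b c = (if b = c then 1 else 0)" if "b \<in> B" "c \<in> B" for b c
    using that B by auto
  fix x assume "x \<in> V"
  then have "x \<in> vec.span B" using B by simp
  then obtain u where u: "x = (\<Sum>b\<in>B. u b *s b)"
    using vec.span_finite[OF fin] by auto
  have "hinner x c = u c" if "c \<in> B" for c
  proof -
    have "hinner x c = (\<Sum>b\<in>B. if c = b then u b else 0)"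
      using that B by (auto simp: u hinner_linear intro!: sum.cong)
    then show ?thesis using that fin by simp
  qed
  then show "x = (\<Sum>b\<in>B. hinner x b *s b)" using u by simp
qed

context orthonormal_family
begin

text \<open>The witness that gives the choice in \<open>trace_on\<close> its meaning.\<close>

lemma orthonormal_basis_image: "orthonormal_basis_of V (e ` I)"
  unfolding orthonormal_basis_of_def
proof
  have "vec.span (e ` I) \<subseteq> V"
    using subspace e_in by (intro vec.span_minimal) auto
  moreover have "x \<in> vec.span (e ` I)" if "x \<in> V" for x
    by (subst expansion[OF that]) (intro vec.span_sum vec.span_scale vec.span_base, auto)
  ultimately show "vec.span (e ` I) = V" by auto
  show "\<forall>b\<in>e ` I. \<forall>c\<in>e ` I. hinner b c = (if b = c then 1 else 0)"
  proof safe
    fix i j assume ij: "i \<in> I" "j \<in> I"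
    have "i = j" if "e i = e j"
      using ortho[OF ij] ortho[of j j] ij that by (auto split: if_splits)
    then show "hinner (e i) (e j) = (if e i = e j then 1 else 0)"
      using ortho[OF ij] by auto
  qed
qed

text \<open>The basis in \<open>trace_on\<close> is arbitrary, so its choice has to be eliminated:
  after exchanging the sums, Parseval in that basis reduces the inner sum to
  \<open>hinner (e i) (e i)\<close>.\<close>

lemma trace_diagonal:
  assumes T: "\<And>x. x \<in> V \<Longrightarrow> T x = (\<Sum>i\<in>I. (c i * hinner x (e i)) *s e i)"
  shows "trace_on V T = (\<Sum>i\<in>I. c i)"
proof -
  define B where "B = (SOME B. orthonormal_basis_of V B)"
  have "orthonormal_basis_of V B"
    unfolding B_def using orthonormal_basis_image by (rule someI)
  then interpret B: orthonormal_family B "\<lambda>b. b" V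
    by (rule orthonormal_family_of_basis)
  have "trace_on V T = (\<Sum>b\<in>B. \<Sum>i\<in>I. c i * (hinner b (e i) * hinner (e i) b))"
    unfolding trace_on_def B_def[symmetric]
    by (intro sum.cong) (simp_all add: T B.e_in hinner_linear mult.assoc)
  also have "\<dots> = (\<Sum>i\<in>I. \<Sum>b\<in>B. c i * (hinner b (e i) * hinner (e i) b))"
    by (rule sum.swap)
  also have "\<dots> = (\<Sum>i\<in>I. c i * hinner (e i) (e i))"
  proof (intro sum.cong)
    fix i assume "i \<in> I"
    then have "(\<Sum>b\<in>B. hinner b (e i) * hinner (e i) b) = hinner (e i) (e i)"
      using B.parseval[OF e_in, of i "e i"] by (simp add: cnj_hinner mult.commute)
    then show "(\<Sum>b\<in>B. c i * (hinner b (e i) * hinner (e i) b)) = c i * hinner (e i) (e i)"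
      by (simp flip: sum_distrib_left)
  qed simp
  also have "\<dots> = (\<Sum>i\<in>I. c i)" by (simp add: ortho)
  finally show ?thesis .
qed

text \<open>The functional calculus acts twice, with exponent 1/2 for the modulus and then with
  \<open>r\<close>. The nested powers stay unsimplified, so the weights have one form on both sides
  of the theorem.\<close>

lemma op_abs_powr_diagonal:
  assumes adj: "\<And>x. x \<in> V \<Longrightarrow> adjoint_on V T (T x) = (\<Sum>i\<in>I. (of_real (s i) * hinner x (e i)) *s e i)"
    and "x \<in> V"
  shows "op_powr V (op_abs V T) r x =
    (\<Sum>i\<in>I. (of_real ((s i powr (1/2)) powr r) * hinner x (e i)) *s e i)"
proof (rule op_powr_diagonal)
  fix x assume "x \<in> V"
  then show "op_abs V T x = (\<Sum>i\<in>I. (of_real (s i powr (1/2)) * hinner x (e i)) *s e i)"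
    unfolding op_abs_def by (intro op_powr_diagonal) (simp_all add: adj)
qed fact

end

text \<open>Two candidates differ by a vector of \<open>V\<close> that is orthogonal to itself, so
  exhibiting one identifies the adjoint.\<close>

lemma adjoint_on_eqI:
  assumes "vec.subspace V" "z \<in> V" and z: "\<And>y. y \<in> V \<Longrightarrow> hinner (T y) x = hinner y z"
  shows "adjoint_on V T x = z"
  unfolding adjoint_on_def
proof (rule the_equality)
  fix w assume w: "w \<in> V \<and> (\<forall>y\<in>V. hinner (T y) x = hinner y w)"
  then have "w - z \<in> V" using assms by (auto intro: vec.subspace_diff)
  then have "hinner (w - z) w = hinner (w - z) z" using w z by metis
  then have "hinner (w - z) (w - z) = 0" by (simp add: hinner_diff_right)
  then show "w = z" by (simp add: hinner_self_eq_0_iff)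
qed (use assms in auto)

section \<open>Spectral theorem for self-adjoint matrices\<close>

lemma quadratic_nonneg_imp_linear_zero:
  fixes c d :: real
  assumes "\<And>t. 0 \<le> 2 * t * c + t\<^sup>2 * d"
  shows "c = 0"
proof (rule ccontr)
  assume "c \<noteq> 0"
  \<comment> \<open>At \<open>t = - c / D\<close> the quadratic equals
    \<open>c\<^sup>2 * (d - 2 * D) / D\<^sup>2\<close>, which is negative once \<open>2 * D\<close>
    exceeds \<open>d\<close>.\<close>
  define D where "D = \<bar>d\<bar> + 1"
  have D: "0 < D" "d < 2 * D" unfolding D_def by auto
  have "0 \<le> 2 * (- c / D) * c + (- c / D)\<^sup>2 * d" by (rule assms)
  also have "\<dots> = c\<^sup>2 * (d - 2 * D) / D\<^sup>2"
    using D by (simp add: field_simps power2_eq_square)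
  also have "\<dots> < 0"
    using \<open>c \<noteq> 0\<close> D by (intro divide_neg_pos mult_pos_neg) auto
  finally show False by simp
qed

lemma continuous_on_hinner [continuous_intros]:
  assumes "continuous_on S f" "continuous_on S g"
  shows "continuous_on S (\<lambda>x. hinner (f x) (g x))"
  unfolding hinner_def using assms by (intro continuous_intros)

text \<open>A maximiser of the Rayleigh quotient on the unit sphere of \<open>W\<close> is an eigenvector.\<close>

lemma selfadjoint_exists_eigenvector:
  fixes H :: "complex ^ 'n::finite ^ 'n" and W :: "(complex ^ 'n) set"
  assumes H: "\<And>x y. hinner (H *v x) y = hinner x (H *v y)"
    and W: "vec.subspace W" "closed W" "\<And>x. x \<in> W \<Longrightarrow> H *v x \<in> W"
    and "x0 \<in> W" "x0 \<noteq> 0"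
  obtains w m where "w \<in> W" "norm w = 1" "H *v w = of_real m *s w"
proof -
  let ?f = "\<lambda>x. Re (hinner (H *v x) x)"
  have sc: "complex_of_real t *s x = t *\<^sub>R x" for t and x :: "complex ^ 'n"
    by (simp add: vec_eq_iff) (simp add: scaleR_conv_of_real)
  have scW: "t *\<^sub>R x \<in> W" if "x \<in> W" for t x
    using vec.subspace_scale[OF W(1) that, of "of_real t"] by (simp add: sc)
  have fsc: "?f (t *\<^sub>R x) = t\<^sup>2 * ?f x" for t x
    by (simp add: hinner_linear vector_scalar_commute power2_eq_square flip: sc)
  have "compact (W \<inter> sphere 0 1)"
    using W(2) by (intro closed_Int_compact) auto
  moreover have "(1 / norm x0) *\<^sub>R x0 \<in> W \<inter> sphere 0 1"
    using scW assms by auto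
  moreover have "continuous_on (W \<inter> sphere 0 1) ?f"
    unfolding matrix_vector_mult_def by (intro continuous_intros)
  ultimately obtain w where w: "w \<in> W" "norm w = 1" and max: "\<And>x. x \<in> W \<Longrightarrow> norm x = 1 \<Longrightarrow> ?f x \<le> ?f w"
    using continuous_attains_sup[of "W \<inter> sphere 0 1" ?f] by fastforce
  let ?m = "?f w"
  have le: "?f x \<le> ?m * (norm x)\<^sup>2" if "x \<in> W" for x
  proof (cases "x = 0")
    case False
    have "?f ((1 / norm x) *\<^sub>R x) \<le> ?m"
      using scW that False by (intro max) auto
    then show ?thesis
      unfolding fsc using False by (simp add: field_simps power2_eq_square)
  qed (simp add: hinner_linear)
  \<comment> \<open>The residual of the eigenvalue equation serves as the direction of
    variation.\<close>
  define y where "y = H *v w - of_real ?m *s w"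
  have y: "y \<in> W"
    unfolding y_def using W w by (intro vec.subspace_diff vec.subspace_scale) auto
  have "Re (hinner y y) = 0"
  proof -
    \<comment> \<open>The gap \<open>?m * (norm u)\<^sup>2 - ?f u\<close> is nonnegative on
      \<open>W\<close> and zero at \<open>w\<close>. Along \<open>w + t y\<close> its linear
      coefficient is minus twice the squared norm of \<open>y\<close>, and it must vanish at a
      minimum.\<close>
    have "0 \<le> 2 * t * (- Re (hinner y y)) + t\<^sup>2 * (?m * (norm y)\<^sup>2 - ?f y)" for t
    proof -
      let ?u = "w + of_real t *s y"
      have "?u \<in> W" using W w y by (intro vec.subspace_add vec.subspace_scale) auto
      then have 1: "0 \<le> ?m * Re (hinner ?u ?u) - ?f ?u"
        using le[of ?u] by (simp add: hinner_self)
      have 2: "?f ?u = ?f w + 2 * t * Re (hinner (H *v w) y) + t\<^sup>2 * ?f y"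
      proof -
        have "Re (hinner (H *v y) w) = Re (hinner (H *v w) y)"
          by (metis H cnj_hinner complex_cnj_cancel_iff cnj.simps(1))
        then show ?thesis
          by (simp add: hinner_linear matrix_vector_right_distrib vector_scalar_commute
              power2_eq_square algebra_simps)
      qed
      have 3: "Re (hinner ?u ?u) = 1 + 2 * t * Re (hinner w y) + t\<^sup>2 * (norm y)\<^sup>2"
      proof -
        have "Re (hinner y w) = Re (hinner w y)"
          by (metis cnj_hinner cnj.simps(1))
        then show ?thesis
          using w by (simp add: hinner_linear algebra_simps) (simp add: hinner_self power2_eq_square)
      qed
      have 4: "Re (hinner y y) = Re (hinner (H *v w) y) - ?m * Re (hinner w y)"
        by (subst (1) y_def) (simp add: hinner_linear)
      show ?thesis
        using 1 unfolding 2 3 4 by (simp add: algebra_simps)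
    qed
    then have "- Re (hinner y y) = 0" by (rule quadratic_nonneg_imp_linear_zero)
    then show ?thesis by simp
  qed
  then have "y = 0" by (simp add: hinner_self)
  then have "H *v w = of_real ?m *s w" by (simp add: y_def)
  then show thesis using w that by blast
qed

text \<open>Independence bounds the size of orthonormal sets of eigenvectors, so a largest one
  exists. Its orthogonal complement is invariant under \<open>H\<close>; a nonzero complement would
  contain one more eigenvector.\<close>

lemma selfadjoint_spectral:
  fixes H :: "complex ^ 'n::finite ^ 'n"
  assumes H: "\<And>x y. hinner (H *v x) y = hinner x (H *v y)"
  obtains e :: "'n \<Rightarrow> complex ^ 'n" and s :: "'n \<Rightarrow> real"
  where "orthonormal_family UNIV e UNIV" "\<And>j. H *v e j = of_real (s j) *s e j"
proof -
  define P where "P S \<longleftrightarrow> (\<forall>b\<in>S. \<forall>c\<in>S. hinner b c = (if b = c then 1 else 0)) \<and>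
    (\<forall>b\<in>S. \<exists>m::real. H *v b = of_real m *s b)" for S
  have bound: "finite S \<and> card S \<le> CARD('n)" if "P S" for S
  proof -
    have "vec.independent S" using that by (intro independent_orthonormal) (auto simp: P_def)
    then show ?thesis
      using vec.independent_card_le_dim[of S UNIV] vec.finiteI_independent by (auto simp: vec_dim_card card_cart_basis)
  qed
  have "P {}" by (simp add: P_def)
  then obtain S where S: "P S" and max: "\<And>S'. P S' \<Longrightarrow> card S' \<le> card S"
    using ex_has_greatest_nat[of P "{}" card "Suc CARD('n)"] bound
    by (auto simp: less_Suc_eq_le)
  have fin: "finite S" using bound S by auto
  have Sortho: "hinner b c = (if b = c then 1 else 0)" if "b \<in> S" "c \<in> S" for b c
    using S that by (auto simp: P_def)
  define W where "W = {x. \<forall>b\<in>S. hinner x b = 0}"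
  have "x = 0" if x: "x \<in> W" for x
  proof (rule ccontr)
    assume "x \<noteq> 0"
    have "vec.subspace W"
      by (auto simp: W_def vec.subspace_def hinner_linear)
    moreover have "closed W"
    proof -
      have "W = (\<Inter>b\<in>S. {x. hinner x b = 0})" by (auto simp: W_def)
      then show ?thesis by (auto intro!: closed_INT closed_Collect_eq continuous_intros)
    qed
    moreover have "H *v x \<in> W" if "x \<in> W" for x
      using that S unfolding W_def P_def by (fastforce simp: H hinner_linear)
    ultimately obtain w m where w: "w \<in> W" "norm w = 1" "H *v w = of_real m *s w"
      using selfadjoint_exists_eigenvector[OF H _ _ _ x \<open>x \<noteq> 0\<close>] by metis
    have 0: "hinner w b = 0" "hinner b w = 0" if "b \<in> S" for b
      using w that cnj_hinner[of w b] by (auto simp: W_def)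
    have 1: "hinner w w = 1" using w by (simp add: hinner_self)
    then have "w \<notin> S" using 0 by force
    have "P (insert w S)"
      unfolding P_def using S w 0 1 \<open>w \<notin> S\<close> by (auto simp: P_def)
    then show False using max[of "insert w S"] fin \<open>w \<notin> S\<close> by simp
  qed
  note W0 = this
  have expansion: "x = (\<Sum>b\<in>S. hinner x b *s b)" for x
  proof -
    have "hinner (x - (\<Sum>b\<in>S. hinner x b *s b)) c = 0" if "c \<in> S" for c
    proof -
      have "hinner (\<Sum>b\<in>S. hinner x b *s b) c = (\<Sum>b\<in>S. if c = b then hinner x b else 0)"
        using that Sortho by (auto simp: hinner_linear intro!: sum.cong)
      then show ?thesis using that fin by (simp add: hinner_linear)
    qed
    then show ?thesis using W0[of "x - (\<Sum>b\<in>S. hinner x b *s b)"] by (simp add: W_def)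
  qed
  have "vec.span S = UNIV"
  proof -
    have "x \<in> vec.span S" for x
      by (subst expansion) (intro vec.span_sum vec.span_scale vec.span_base, auto)
    then show ?thesis by auto
  qed
  moreover have "vec.independent S" using Sortho by (rule independent_orthonormal)
  ultimately have "card S = CARD('n)"
    using vec.dim_eq_card[of S UNIV] by (simp add: vec_dim_card card_cart_basis)
  then obtain e where e: "bij_betw e (UNIV :: 'n set) S"
    using fin finite_same_card_bij[of "UNIV :: 'n set" S] by auto
  have eS: "e j \<in> S" for j using e by (auto simp: bij_betw_def)
  have einj: "e i = e j \<longleftrightarrow> i = j" for i j using e by (auto simp: bij_betw_def inj_on_def)
  have "\<forall>j. \<exists>m::real. H *v e j = of_real m *s e j"
    using S eS by (auto simp: P_def)
  then obtain s :: "'n \<Rightarrow> real" where "\<And>j. H *v e j = of_real (s j) *s e j" by metis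
  moreover have "orthonormal_family UNIV e UNIV"
  proof
    show "x = (\<Sum>j\<in>UNIV. hinner x (e j) *s e j)" for x
      using sum.reindex_bij_betw[OF e, of "\<lambda>b. hinner x b *s b"] expansion[of x] by simp
  qed (use Sortho eS einj in auto)
  ultimately show thesis using that by blast
qed

section \<open>Symmetric tensors\<close>

definition ctranspose :: "complex ^ 'n ^ 'm \<Rightarrow> complex ^ 'm ^ 'n" where
  "ctranspose A = (\<chi> i j. cnj (A $ j $ i))"

lemma hinner_ctranspose:
  fixes A :: "complex ^ 'n::finite ^ 'm::finite"
  shows "hinner (A *v x) y = hinner x (ctranspose A *v y)"
proof -
  have "hinner (A *v x) y = (\<Sum>i\<in>UNIV. \<Sum>j\<in>UNIV. A $ i $ j * x $ j * cnj (y $ i))"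
    by (simp add: hinner_def matrix_vector_mult_def sum_distrib_right)
  also have "\<dots> = (\<Sum>j\<in>UNIV. \<Sum>i\<in>UNIV. A $ i $ j * x $ j * cnj (y $ i))"
    by (rule sum.swap)
  also have "\<dots> = hinner x (ctranspose A *v y)"
    by (simp add: hinner_def matrix_vector_mult_def ctranspose_def sum_distrib_left mult_ac)
  finally show ?thesis .
qed

lemma ctranspose_tensor_power: "ctranspose (tensor_power A) = tensor_power (ctranspose A)"
  by (simp add: ctranspose_def tensor_power_def vec_eq_iff)

lemma matrix_vector_mult_sum:
  fixes B :: "complex ^ 'n::finite ^ 'm"
  shows "B *v (\<Sum>i\<in>I. f i) = (\<Sum>i\<in>I. B *v f i)"
  by (induction I rule: infinite_finite_induct) (simp_all add: matrix_vector_right_distrib)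

lemma (in orthonormal_family) matrix_eigenbasis_expansion:
  assumes "\<And>i. i \<in> I \<Longrightarrow> B *v e i = c i *s e i" and "x \<in> V"
  shows "B *v x = (\<Sum>i\<in>I. (c i * hinner x (e i)) *s e i)"
proof -
  have "B *v x = (\<Sum>i\<in>I. hinner x (e i) *s (B *v e i))"
    by (subst expansion[OF assms(2)]) (simp add: matrix_vector_mult_sum vector_scalar_commute)
  then show ?thesis using assms(1) by (simp add: mult.commute)
qed

text \<open>As many independent vectors as the dimension span the space, so orthonormality alone
  yields the expansion.\<close>

lemma orthonormal_family_UNIV:
  fixes e :: "'b::finite \<Rightarrow> complex ^ 'b"
  assumes "\<And>i j. hinner (e i) (e j) = (if i = j then 1 else 0)"
  shows "orthonormal_family UNIV e UNIV"
proof -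
  have inj: "inj e"
    by (rule injI) (metis assms zero_neq_one)
  have ortho: "hinner b c = (if b = c then 1 else 0)" if "b \<in> range e" "c \<in> range e" for b c
    using that assms inj by (auto simp: inj_eq)
  have "vec.independent (range e)" using ortho by (rule independent_orthonormal)
  then have "UNIV \<subseteq> vec.span (range e)"
    using inj by (intro vec.card_ge_dim_independent) (auto simp: card_image vec_dim_card card_cart_basis)
  then interpret B: orthonormal_family "range e" "\<lambda>b. b" UNIV
    using ortho by (intro orthonormal_family_of_basis) (auto simp: orthonormal_basis_of_def)
  show ?thesis
  proof
    show "x = (\<Sum>j\<in>UNIV. hinner x (e j) *s e j)" for x
      using B.expansion[of x] inj by (simp add: sum.reindex)
  qed (use assms in auto)
qed

section \<open>Symmetrised tensors of an orthonormal basis\<close>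

definition basis_tensor ::
  "('n \<Rightarrow> complex ^ 'n::finite) \<Rightarrow> ('k::finite \<Rightarrow> 'n) \<Rightarrow> complex ^ ('k \<Rightarrow> 'n)" where
  "basis_tensor e f = elementary_tensor (\<lambda>i. e (f i))"

lemma basis_tensor_permute:
  assumes "bij \<pi>"
  shows "basis_tensor e (f \<circ> \<pi>) $ (g \<circ> \<pi>) = basis_tensor e f $ g"
  using prod.reindex_bij_betw[OF assms, of "\<lambda>i. e (f i) $ g i"]
  by (simp add: basis_tensor_def elementary_tensor_def)

lemma bij_comp_right:
  assumes "bij \<pi>"
  shows "bij (\<lambda>f. f \<circ> \<pi>)"
  by (rule o_bij[where g = "\<lambda>f. f \<circ> inv \<pi>"])
    (use assms in \<open>auto simp: fun_eq_iff bij_is_inj bij_is_surj surj_f_inv_f\<close>)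

lemma mset_of_fun_permute:
  assumes "bij \<pi>"
  shows "mset_of_fun (f \<circ> \<pi>) = mset_of_fun f"
proof -
  have "image_mset \<pi> (mset_set UNIV) = mset_set UNIV"
    using assms by (simp add: bij_is_inj bij_is_surj image_mset_mset_set)
  then show ?thesis
    by (simp add: mset_of_fun_def flip: multiset.map_comp)
qed

text \<open>With \<open>mset_of_fun_permute\<close>, this identifies the fibres of
  \<open>mset_of_fun\<close> as the orbits under permutations of the tensor positions.\<close>

lemma mset_of_fun_eq_imp_permute:
  fixes f g :: "'k::finite \<Rightarrow> 'n"
  assumes "mset_of_fun f = mset_of_fun g"
  obtains \<pi> where "bij \<pi>" "f = g \<circ> \<pi>"
proof -
  obtain \<pi> where "\<pi> permutes UNIV" "\<forall>x\<in>UNIV. f x = g (\<pi> x)"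
    using image_mset_eq_implies_permutes[of UNIV f g] assms unfolding mset_of_fun_def
    by auto
  then show thesis using that[of \<pi>] permutes_bij[of \<pi>] by (simp add: fun_eq_iff)
qed

definition class_tensor :: 
  "('n \<Rightarrow> complex ^ 'n::finite) \<Rightarrow> 'n multiset \<Rightarrow> complex ^ ('k::finite \<Rightarrow> 'n)" where
  "class_tensor e M = (\<Sum>f\<in>{f. mset_of_fun f = M}. basis_tensor e f)"

text \<open>For orthonormal \<open>e\<close> the terms of the orbit sum are orthonormal, so its
  squared norm is their number.\<close>

definition sym_basis ::
  "('n \<Rightarrow> complex ^ 'n::finite) \<Rightarrow> 'n multiset \<Rightarrow> complex ^ ('k::finite \<Rightarrow> 'n)" where
  "sym_basis e M = of_real (1 / sqrt (card {f :: 'k \<Rightarrow> 'n. mset_of_fun f = M})) *s class_tensor e M"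

lemma class_tensor_in_sym_tensors:
  "(class_tensor e M :: complex ^ ('k::finite \<Rightarrow> 'n::finite)) \<in> sym_tensors"
  unfolding sym_tensors_def
proof (intro CollectI allI impI)
  fix \<pi> :: "'k \<Rightarrow> 'k" and g :: "'k \<Rightarrow> 'n" assume \<pi>: "bij \<pi>"
  let ?C = "{f :: 'k \<Rightarrow> 'n. mset_of_fun f = M}"
  have "bij_betw (\<lambda>f. f \<circ> \<pi>) ?C ?C"
  proof (rule bij_betw_imageI)
    have "bij (\<lambda>f :: 'k \<Rightarrow> 'n. f \<circ> \<pi>)" using \<pi> by (rule bij_comp_right)
    then show "inj_on (\<lambda>f. f \<circ> \<pi>) ?C"
      by (auto intro: inj_on_subset bij_is_inj)
    show "(\<lambda>f. f \<circ> \<pi>) ` ?C = ?C"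
    proof (intro equalityI subsetI)
      fix f assume "f \<in> ?C"
      then have "f = (f \<circ> inv \<pi>) \<circ> \<pi>" "f \<circ> inv \<pi> \<in> ?C"
        using \<pi> mset_of_fun_permute[OF bij_imp_bij_inv[OF \<pi>]] by (auto simp: fun_eq_iff bij_is_inj)
      then show "f \<in> (\<lambda>f. f \<circ> \<pi>) ` ?C" by blast
    qed (use mset_of_fun_permute[OF \<pi>] in auto)
  qed
  then have "(\<Sum>f\<in>?C. basis_tensor e f $ (g \<circ> \<pi>)) = (\<Sum>f\<in>?C. basis_tensor e (f \<circ> \<pi>) $ (g \<circ> \<pi>))"
    by (rule sum.reindex_bij_betw[symmetric])
  then show "class_tensor e M $ (g \<circ> \<pi>) = class_tensor e M $ g"
    by (simp add: class_tensor_def basis_tensor_permute[OF \<pi>])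
qed

text \<open>Coefficients of a symmetric tensor are constant along orbits, which lets its expansion
  in basis tensors collapse to orbit sums.\<close>

lemma hinner_sym_tensor_permute:
  fixes t :: "complex ^ ('k::finite \<Rightarrow> 'n::finite)"
  assumes "t \<in> sym_tensors" "bij \<pi>"
  shows "hinner t (basis_tensor e (f \<circ> \<pi>)) = hinner t (basis_tensor e f)"
proof -
  have "bij (\<lambda>g :: 'k \<Rightarrow> 'n. g \<circ> \<pi>)" using assms(2) by (rule bij_comp_right)
  from sum.reindex_bij_betw[OF this, of "\<lambda>g. t $ g * cnj (basis_tensor e (f \<circ> \<pi>) $ g)"]
  show ?thesis
    using assms by (simp add: hinner_def basis_tensor_permute sym_tensors_def)
qed

lemma card_mset_class_pos:
  fixes M :: "'n::finite multiset"
  assumes "M \<in> multisets_of_size UNIV CARD('k::finite)"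
  shows "0 < card {f :: 'k \<Rightarrow> 'n. mset_of_fun f = M}"
  using card_mset_of_fun[of M, where 'k='k] assms
  by (auto simp: multisets_of_size_def intro!: gr0I)

lemma basis_tensor_orthonormal_family:
  assumes "orthonormal_family UNIV e UNIV"
  shows "orthonormal_family UNIV (basis_tensor e :: ('k::finite \<Rightarrow> 'n::finite) \<Rightarrow> _) UNIV"
proof (rule orthonormal_family_UNIV)
  interpret orthonormal_family UNIV e UNIV by fact
  fix f g :: "'k \<Rightarrow> 'n"
  have "hinner (basis_tensor e f) (basis_tensor e g) = (\<Prod>i\<in>UNIV. if f i = g i then 1 else 0)"
    by (simp add: basis_tensor_def hinner_elementary_tensor ortho)
  also have "\<dots> = (if f = g then 1 else 0)"
    by (auto simp: fun_eq_iff)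
  finally show "hinner (basis_tensor e f) (basis_tensor e g) = (if f = g then 1 else 0)" .
qed

text \<open>Orthogonality holds because distinct orbits are disjoint. For completeness, expand a
  symmetric tensor in all basis tensors and collect each orbit, on which the coefficient is
  constant.\<close>

lemma sym_basis_orthonormal_family:
  fixes e :: "'n::finite \<Rightarrow> complex ^ 'n"
  assumes "orthonormal_family UNIV e UNIV"
  shows "orthonormal_family (multisets_of_size UNIV CARD('k)) (sym_basis e)
    (sym_tensors :: (complex ^ ('k::finite \<Rightarrow> 'n)) set)"
proof
  interpret T: orthonormal_family UNIV "basis_tensor e :: ('k \<Rightarrow> 'n) \<Rightarrow> _" UNIV
    using assms by (rule basis_tensor_orthonormal_family)
  let ?I = "multisets_of_size (UNIV :: 'n set) CARD('k)"
  let ?C = "\<lambda>M. {f :: 'k \<Rightarrow> 'n. mset_of_fun f = M}"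
  let ?u = "class_tensor e :: 'n multiset \<Rightarrow> complex ^ ('k \<Rightarrow> 'n)"
  show "finite ?I" by (simp add: finite_multisets_of_size)
  show "vec.subspace sym_tensors" by (rule subspace_sym_tensors)
  show "sym_basis e M \<in> sym_tensors" for M
    unfolding sym_basis_def
    using subspace_sym_tensors class_tensor_in_sym_tensors by (rule vec.subspace_scale)
  have hu: "hinner (?u M) (?u N) = (if M = N then of_nat (card (?C M)) else 0)" for M N
  proof -
    have "hinner (?u M) (?u N) = (\<Sum>f\<in>?C M. \<Sum>g\<in>?C N. if f = g then 1 else 0)"
      by (simp add: class_tensor_def hinner_sum_left hinner_sum_right T.ortho)
    also have "\<dots> = (\<Sum>f\<in>?C M. if M = N then 1 else 0)"
      by (intro sum.cong) auto
    finally show ?thesis by simp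
  qed
  have sq: "complex_of_real (1 / sqrt (real n)) * of_real (1 / sqrt (real n)) = 1 / of_nat n" for n
  proof -
    have "1 / sqrt (real n) * (1 / sqrt (real n)) = 1 / real n" by simp
    then have "complex_of_real (1 / sqrt (real n) * (1 / sqrt (real n))) = of_real (1 / real n)"
      by (rule arg_cong)
    then show ?thesis
      by (simp only: of_real_mult of_real_divide of_real_1 of_real_of_nat_eq)
  qed
  have cancel: "1 / of_nat (card (?C M)) * (of_nat (card (?C M)) * x) = x" if "M \<in> ?I" for M and x :: complex
  proof -
    have "complex_of_nat (card (?C M)) \<noteq> 0"
      unfolding of_nat_eq_0_iff using card_mset_class_pos[OF that] by linarith
    then show ?thesis
      using nonzero_mult_div_cancel_left by (simp only: times_divide_eq_left mult_1_left)
  qed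
  show "hinner (sym_basis e M) (sym_basis e N :: complex ^ ('k \<Rightarrow> 'n)) = (if M = N then 1 else 0)"
    if "M \<in> ?I" "N \<in> ?I" for M N
  proof (cases "M = N")
    case True
    have "hinner (sym_basis e M) (sym_basis e M :: complex ^ ('k \<Rightarrow> 'n)) =
        (complex_of_real (1 / sqrt (real (card (?C M)))) * of_real (1 / sqrt (real (card (?C M))))) *
          of_nat (card (?C M))"
      by (simp add: sym_basis_def hinner_linear hu)
    also have "\<dots> = 1"
      unfolding sq using cancel[OF that(1), of 1] by (simp only: mult_1_right)
    finally show ?thesis using True by simp
  qed (simp add: sym_basis_def hinner_linear hu)
  fix t :: "complex ^ ('k \<Rightarrow> 'n)" assume t: "t \<in> sym_tensors"
  have const: "hinner t (basis_tensor e f) = hinner t (basis_tensor e g)"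
    if "mset_of_fun f = mset_of_fun g" for f g
    using that hinner_sym_tensor_permute[OF t] by (metis mset_of_fun_eq_imp_permute)
  have "t = (\<Sum>f\<in>UNIV. hinner t (basis_tensor e f) *s basis_tensor e f)"
    by (rule T.expansion) simp
  also have "\<dots> = (\<Sum>M\<in>?I. \<Sum>f\<in>?C M. hinner t (basis_tensor e f) *s basis_tensor e f)"
    by (subst sum.group[where S = "UNIV :: ('k \<Rightarrow> 'n) set" and g = mset_of_fun and T = ?I, symmetric])
      (simp_all add: mset_of_fun_in image_subset_iff finite_multisets_of_size)
  also have "\<dots> = (\<Sum>M\<in>?I. hinner t (sym_basis e M) *s sym_basis e M)"
  proof (rule sum.cong)
    fix M assume M: "M \<in> ?I"
    have "card (?C M) \<noteq> 0"
      using card_mset_class_pos[OF M] by linarith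
    then have "?C M \<noteq> {}"
      by (rule contrapos_nn) (simp only: card.empty)
    then obtain f where f: "mset_of_fun f = M" "f \<in> ?C M" by blast
    have "(\<Sum>g\<in>?C M. hinner t (basis_tensor e g) *s basis_tensor e g) = hinner t (basis_tensor e f) *s ?u M"
      unfolding class_tensor_def vec.scale_sum_right
      using const f by (intro sum.cong) auto
    moreover have "hinner t (?u M) = of_nat (card (?C M)) * hinner t (basis_tensor e f)"
    proof -
      have "hinner t (?u M) = (\<Sum>g\<in>?C M. hinner t (basis_tensor e f))"
        unfolding class_tensor_def hinner_sum_right using const f by (intro sum.cong) auto
      then show ?thesis by simp
    qed
    \<comment> \<open>The normalisation enters both the coefficient and the vector; the resulting
      reciprocal of the fibre size cancels the fibre size in \<open>hinner t (?u M)\<close>.\<close>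
    moreover have "hinner t (sym_basis e M) *s sym_basis e M =
        ((complex_of_real (1 / sqrt (real (card (?C M)))) * of_real (1 / sqrt (real (card (?C M))))) *
          hinner t (?u M)) *s ?u M"
      by (simp add: sym_basis_def hinner_linear mult_ac)
    ultimately show "(\<Sum>g\<in>?C M. hinner t (basis_tensor e g) *s basis_tensor e g) =
        hinner t (sym_basis e M) *s sym_basis e M"
      by (simp only: sq cancel[OF M])
  qed simp
  finally show "t = (\<Sum>M\<in>?I. hinner t (sym_basis e M) *s sym_basis e M)" .
qed

text \<open>The eigenvalue of a basis tensor depends only on its multiset, so all terms of an orbit
  sum share it.\<close>

lemma tensor_power_sym_basis:
  fixes e :: "'n::finite \<Rightarrow> complex ^ 'n"
  assumes "\<And>j. B *v e j = c j *s e j"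
  shows "tensor_power B *v (sym_basis e M :: complex ^ ('k::finite \<Rightarrow> 'n)) = (\<Prod>j\<in>#M. c j) *s sym_basis e M"
proof -
  have "tensor_power B *v basis_tensor e f = (\<Prod>j\<in>#mset_of_fun f. c j) *s basis_tensor e f" for f :: "'k \<Rightarrow> 'n"
    by (simp add: basis_tensor_def tensor_power_elementary_tensor assms)
      (simp add: elementary_tensor_def vec_eq_iff prod.distrib prod_mset_of_fun)
  then have "tensor_power B *v (class_tensor e M :: complex ^ ('k \<Rightarrow> 'n)) = (\<Prod>j\<in>#M. c j) *s class_tensor e M"
    by (simp add: class_tensor_def matrix_vector_mult_sum vec.scale_sum_right)
  then show ?thesis
    by (simp add: sym_basis_def vector_scalar_commute mult.commute)
qed

text \<open>Multiplicativity makes the Gram operator of a tensor power the tensor power of the Gram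
  matrix.\<close>

lemma tensor_power_matrix_mult:
  fixes A B :: "complex ^ 'n::finite ^ 'n"
  shows "tensor_power A ** tensor_power B =
    (tensor_power (A ** B) :: complex ^ ('k::finite \<Rightarrow> 'n) ^ ('k \<Rightarrow> 'n))"
proof -
  have "(\<Prod>i\<in>UNIV. \<Sum>j\<in>UNIV. A $ f i $ j * B $ j $ g i) =
      (\<Sum>h\<in>UNIV. \<Prod>i\<in>UNIV. A $ f i $ h i * B $ h i $ g i)" for f g :: "'k \<Rightarrow> 'n"
    using prod_sum_PiE[of "UNIV :: 'k set" "\<lambda>_. UNIV" "\<lambda>i j. A $ f i $ j * B $ j $ g i"] by simp
  then show ?thesis
    by (simp add: vec_eq_iff matrix_matrix_mult_def tensor_power_def prod.distrib)
qed

section \<open>Singular values and the Schatten norm of the symmetric power\<close>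

lemma powr_prod_mset:
  fixes s :: "'n \<Rightarrow> real"
  assumes "\<And>j. 0 \<le> s j"
  shows "(\<Prod>j\<in>#M. s j) powr a = (\<Prod>j\<in>#M. s j powr a)" and "0 \<le> (\<Prod>j\<in>#M. s j)"
proof -
  have "(\<Prod>j\<in>#M. s j) powr a = (\<Prod>j\<in>#M. s j powr a) \<and> 0 \<le> (\<Prod>j\<in>#M. s j)"
    by (induction M) (use assms in \<open>simp_all add: powr_mult\<close>)
  then show "(\<Prod>j\<in>#M. s j) powr a = (\<Prod>j\<in>#M. s j powr a)" "0 \<le> (\<Prod>j\<in>#M. s j)" by auto
qed

text \<open>The singular values of \<open>A\<close> are the square roots of the numbers \<open>s j\<close>.\<close>

lemma gram_matrix_spectral:
  fixes A :: "complex ^ 'n::finite ^ 'n"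
  obtains e :: "'n \<Rightarrow> complex ^ 'n" and s :: "'n \<Rightarrow> real"
  where "orthonormal_family UNIV e UNIV"
    "\<And>j. (ctranspose A ** A) *v e j = of_real (s j) *s e j" "\<And>j. 0 \<le> s j"
proof -
  let ?H = "ctranspose A ** A"
  have gram: "hinner (?H *v x) y = hinner (A *v x) (A *v y)" for x y
  proof -
    have "hinner (?H *v x) y = cnj (hinner y (ctranspose A *v (A *v x)))"
      by (simp add: cnj_hinner matrix_vector_mul_assoc)
    then show ?thesis by (simp add: cnj_hinner flip: hinner_ctranspose)
  qed
  have "hinner (?H *v x) y = hinner x (?H *v y)" for x y
    unfolding gram by (simp add: hinner_ctranspose matrix_vector_mul_assoc)
  then obtain e :: "'n \<Rightarrow> complex ^ 'n" and s :: "'n \<Rightarrow> real"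
    where e: "orthonormal_family UNIV e UNIV" "\<And>j. ?H *v e j = of_real (s j) *s e j"
    by (rule selfadjoint_spectral) (rule that)
  interpret orthonormal_family UNIV e UNIV by fact
  have "complex_of_real (s j) = hinner (?H *v e j) (e j)" for j
    by (simp add: e hinner_linear ortho)
  then have "complex_of_real (s j) = of_real ((norm (A *v e j))\<^sup>2)" for j
    by (simp only: gram hinner_self)
  then have "0 \<le> s j" for j
    by (metis of_real_eq_iff zero_le_power2)
  with e that show thesis by blast
qed

lemma op_powr_abs_eq:
  fixes A :: "complex ^ 'n::finite ^ 'n" and e :: "'n \<Rightarrow> complex ^ 'n"
  assumes "orthonormal_family UNIV e UNIV"
    and "\<And>j. (ctranspose A ** A) *v e j = of_real (s j) *s e j"
  shows "op_powr UNIV (op_abs UNIV ((*v) A)) p x =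
    (\<Sum>j\<in>UNIV. (of_real ((s j powr (1/2)) powr p) * hinner x (e j)) *s e j)"
proof -
  interpret orthonormal_family UNIV e UNIV by fact
  have "adjoint_on UNIV ((*v) A) (A *v x) = (\<Sum>j\<in>UNIV. (of_real (s j) * hinner x (e j)) *s e j)" for x
  proof -
    have "adjoint_on UNIV ((*v) A) (A *v x) = (ctranspose A ** A) *v x"
      by (intro adjoint_on_eqI) (simp_all add: hinner_ctranspose matrix_vector_mul_assoc)
    also have "\<dots> = (\<Sum>j\<in>UNIV. (of_real (s j) * hinner x (e j)) *s e j)"
      using assms(2) by (rule matrix_eigenbasis_expansion) simp
    finally show ?thesis .
  qed
  then show ?thesis by (intro op_abs_powr_diagonal) auto
qed

text \<open>\<open>sym_basis e\<close> diagonalises the Gram operator with eigenvalues the products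
  of the \<open>s j\<close>. Real powers pass through these products, and the trace adds them
  up.\<close>

lemma schatten_norm_sym_power:
  fixes A :: "complex ^ 'n::finite ^ 'n" and e :: "'n \<Rightarrow> complex ^ 'n"
  assumes e: "orthonormal_family UNIV e UNIV"
    and s: "\<And>j. (ctranspose A ** A) *v e j = of_real (s j) *s e j" "\<And>j. 0 \<le> s j"
  shows "schatten_norm p (sym_tensors :: (complex ^ ('k::finite \<Rightarrow> 'n)) set) (sym_power A) =
    (\<Sum>M\<in>multisets_of_size UNIV CARD('k). \<Prod>j\<in>#M. (s j powr (1/2)) powr p) powr (1 / p)"
proof -
  let ?V = "sym_tensors :: (complex ^ ('k \<Rightarrow> 'n)) set"
  let ?T = "sym_power A :: complex ^ ('k \<Rightarrow> 'n) \<Rightarrow> _"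
  let ?I = "multisets_of_size (UNIV :: 'n set) CARD('k)"
  interpret S: orthonormal_family ?I "sym_basis e" ?V
    using e by (rule sym_basis_orthonormal_family)
  have T: "sym_power B t = tensor_power B *v t" if "t \<in> ?V" for B t
    using that by (simp add: sym_power_def)
  have "adjoint_on ?V ?T (?T t) = (\<Sum>M\<in>?I. (of_real (\<Prod>j\<in>#M. s j) * hinner t (sym_basis e M)) *s sym_basis e M)"
    if t: "t \<in> ?V" for t
  proof -
    \<comment> \<open>\<open>sym_power\<close> is a restriction with unspecified values outside the
      symmetric tensors, so membership is recorded before a second operator is applied.\<close>
    have "?T t \<in> ?V" using t by (rule sym_power_in_sym_tensors)
    have "adjoint_on ?V ?T (?T t) = sym_power (ctranspose A) (?T t)"
    proof (rule adjoint_on_eqI)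
      show "sym_power (ctranspose A) (?T t) \<in> ?V" using \<open>?T t \<in> ?V\<close> by (rule sym_power_in_sym_tensors)
      show "hinner (?T y) (?T t) = hinner y (sym_power (ctranspose A) (?T t))" if "y \<in> ?V" for y
        using that \<open>?T t \<in> ?V\<close> T by (simp add: hinner_ctranspose ctranspose_tensor_power)
    qed (rule subspace_sym_tensors)
    also have "\<dots> = tensor_power (ctranspose A ** A) *v t"
      using T \<open>?T t \<in> ?V\<close> t by (simp add: matrix_vector_mul_assoc tensor_power_matrix_mult)
    also have "\<dots> = (\<Sum>M\<in>?I. ((\<Prod>j\<in>#M. of_real (s j)) * hinner t (sym_basis e M)) *s sym_basis e M)"
      using tensor_power_sym_basis[OF s(1)] t by (intro S.matrix_eigenbasis_expansion)
    finally show ?thesis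
      by (simp add: prod_mset_power_count)
  qed
  then have "op_powr ?V (op_abs ?V ?T) p t =
      (\<Sum>M\<in>?I. (of_real (((\<Prod>j\<in>#M. s j) powr (1/2)) powr p) * hinner t (sym_basis e M)) *s sym_basis e M)"
    if "t \<in> ?V" for t
    using that by (rule S.op_abs_powr_diagonal)
  then have "trace_on ?V (op_powr ?V (op_abs ?V ?T) p) = (\<Sum>M\<in>?I. of_real (((\<Prod>j\<in>#M. s j) powr (1/2)) powr p))"
    by (rule S.trace_diagonal)
  also have "\<dots> = of_real (\<Sum>M\<in>?I. \<Prod>j\<in>#M. (s j powr (1/2)) powr p)"
    using s(2) by (simp add: powr_prod_mset)
  finally show ?thesis
    by (simp only: schatten_norm_def Re_complex_of_real)
qed

section \<open>Integration over the sphere\<close>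

text \<open>The mean over the sphere is the mean over the ball of the degree-zero extension.
  Comparison with the form whose weights are all 1 removes the radial and Gaussian
  constants.\<close>

lemma sphere_measure_diagonal_form:
  fixes e :: "'n::finite \<Rightarrow> complex ^ 'n" and w :: "'n \<Rightarrow> real"
  assumes e: "orthonormal_family UNIV e UNIV" and w: "\<And>j. 0 \<le> w j"
  shows "(LINT \<xi>:sphere 0 1|sphere_measure. (\<Sum>j\<in>UNIV. w j * (cmod (hinner \<xi> (e j)))\<^sup>2) powr real CARD('k::finite)) =
    (\<Sum>M\<in>multisets_of_size UNIV CARD('k). \<Prod>j\<in>#M. w j) / real ((CARD('n) + CARD('k) - 1) choose CARD('k))"
proof -
  interpret orthonormal_family UNIV e UNIV by fact
  let ?I = "multisets_of_size (UNIV :: 'n set) CARD('k)"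
  let ?k = "CARD('k)"
  let ?B = "cball (0 :: complex ^ 'n) 1"
  define Q where "Q \<xi> = (\<Sum>j\<in>UNIV. w j * (cmod (hinner \<xi> (e j)))\<^sup>2)" for \<xi>
  \<comment> \<open>Coordinates with respect to \<open>e\<close>: by Parseval an isometry, hence
    compatible with Lebesgue measure and the Gaussian.\<close>
  define U where "U \<xi> = (\<chi> j. hinner \<xi> (e j))" for \<xi>
  define S where "S = (\<Sum>M\<in>?I. \<Prod>j\<in>#M. w j)"
  define c where "c = pi ^ CARD('n) * fact ?k"
  \<comment> \<open>Composition with \<open>sgn\<close> gives homogeneity of degree zero and matches
    the radial projection that defines \<open>sphere_measure\<close>.\<close>
  define h where "h \<xi> = ennreal (Q (sgn \<xi>) ^ ?k)" for \<xi>
  have Q_nonneg: "0 \<le> Q \<xi>" for \<xi> unfolding Q_def using w by (intro sum_nonneg) auto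
  have S_nonneg: "0 \<le> S" unfolding S_def by (intro sum_nonneg) (simp add: prod_mset_power_count prod_nonneg w)
  have c_pos: "0 < c" by (simp add: c_def)
  have sc: "t *\<^sub>R x = complex_of_real t *s x" for t and x :: "complex ^ 'n"
    by (simp add: vec_eq_iff) (simp add: scaleR_conv_of_real)
  have Q_scale: "Q (t *\<^sub>R x) = t\<^sup>2 * Q x" for t x
    by (simp add: Q_def sc hinner_linear norm_mult power_mult_distrib sum_distrib_left mult_ac)
  have norm_U: "norm (U x) = norm x" for x
  proof -
    have "complex_of_real ((norm (U x))\<^sup>2) = of_real ((norm x)\<^sup>2)"
      unfolding hinner_self[symmetric] parseval[of x x, simplified] by (simp add: hinner_def U_def)
    then show ?thesis by (simp only: of_real_eq_iff) simp
  qed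
  have "linear U"
    by (rule linearI) (simp_all add: U_def vec_eq_iff hinner_linear sc)
  then have U: "orthogonal_transformation U"
    by (simp add: orthogonal_transformation norm_U)
  have Q_U: "Q x = (\<Sum>j\<in>UNIV. w j * (cmod (U x $ j))\<^sup>2)" for x
    by (simp add: Q_def U_def)
  \<comment> \<open>This bound makes the integral \<open>a\<close> over the ball finite.\<close>
  have Q_bound: "Q x \<le> (\<Sum>j\<in>UNIV. w j)" if "norm x \<le> 1" for x
    unfolding Q_U
  proof (rule sum_mono)
    fix j
    have "cmod (U x $ j) \<le> 1"
      using Finite_Cartesian_Product.norm_nth_le[of "U x" j] that norm_U by simp
    then show "w j * (cmod (U x $ j))\<^sup>2 \<le> w j"
      using w by (simp add: mult_left_le power_le_one)
  qed
  have [measurable]: "Q \<in> borel_measurable borel"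
    unfolding Q_def by (intro borel_measurable_continuous_onI continuous_intros)
  note sgn_borel_measurable [measurable]
  have [measurable]: "h \<in> borel_measurable borel" unfolding h_def by measurable
  have gauss: "(\<integral>\<^sup>+x. ennreal ((\<Sum>j\<in>UNIV. v j * (cmod (U x $ j))\<^sup>2) ^ ?k * exp (- (norm x)\<^sup>2)) \<partial>lborel) =
      ennreal (c * (\<Sum>M\<in>?I. \<Prod>j\<in>#M. v j))" if "\<And>j. 0 \<le> v j" for v
  proof -
    note measurable_vec_nth[measurable]
    have "(\<integral>\<^sup>+x. ennreal ((\<Sum>j\<in>UNIV. v j * (cmod (U x $ j))\<^sup>2) ^ ?k * exp (- (norm (U x))\<^sup>2)) \<partial>lborel) =
        (\<integral>\<^sup>+x. ennreal ((\<Sum>j\<in>UNIV. v j * (cmod (x $ j))\<^sup>2) ^ ?k * exp (- (norm x)\<^sup>2)) \<partial>lborel)"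
      using U by (intro nn_integral_lborel_orthogonal) auto
    then show ?thesis
      using nn_integral_gaussian_diagonal_form[of v, where 'k='k] that by (simp add: norm_U c_def)
  qed
  define a where "a = (\<integral>\<^sup>+x. h x * indicator ?B x \<partial>lborel)"
  have v: "emeasure lborel ?B \<noteq> 0" "emeasure lborel ?B \<noteq> \<infinity>"
    using emeasure_cball_pos[where 'a="complex ^ 'n"] emeasure_compact_finite[of ?B] by auto
  have "a \<le> (\<integral>\<^sup>+x. ennreal ((\<Sum>j\<in>UNIV. w j) ^ ?k) * indicator ?B x \<partial>lborel)"
    unfolding a_def h_def
    by (intro nn_integral_mono mult_right_mono ennreal_leI power_mono Q_bound Q_nonneg)
      (auto simp: norm_sgn)
  also have "\<dots> < \<infinity>"
    using v by (simp add: nn_integral_cmult_indicator ennreal_mult_less_top less_top)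
  finally have a_fin: "a \<noteq> \<infinity>" by simp
  have "a * (\<integral>\<^sup>+x. ennreal (norm (x :: complex ^ 'n) ^ (2 * ?k) * exp (- (norm x)\<^sup>2)) \<partial>lborel) =
      emeasure lborel ?B * (\<integral>\<^sup>+x. h x * ennreal (norm x ^ (2 * ?k) * exp (- (norm x)\<^sup>2)) \<partial>lborel)"
    unfolding a_def
  \<comment> \<open>The radial factor restores the degree \<open>2 * ?k\<close> and adds the
    Gaussian weight, turning \<open>h\<close> into \<open>Q x ^ ?k\<close> times the
    Gaussian.\<close>
  proof (rule nn_integral_homogeneous_radial[where \<phi> = "\<lambda>r. ennreal (r ^ (2 * ?k) * exp (- r\<^sup>2))"])
    show "h (r *\<^sub>R x) = h x" if "0 < r" for r x
      using that by (simp add: h_def sgn_scaleR)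
    show "(\<integral>\<^sup>+x. h x * indicator ?B x \<partial>lborel) \<noteq> \<infinity>"
      using a_fin by (simp add: a_def)
  qed auto
  moreover have "h x * ennreal (norm x ^ (2 * ?k) * exp (- (norm x)\<^sup>2)) = ennreal (Q x ^ ?k * exp (- (norm x)\<^sup>2))" for x
  proof -
    have "Q x = (norm x)\<^sup>2 * Q (sgn x)"
      using Q_scale[of "norm x" "sgn x"] by (cases "x = 0") (auto simp: sgn_div_norm)
    then have "Q x ^ ?k = norm x ^ (2 * ?k) * Q (sgn x) ^ ?k"
      by (simp add: power_mult_distrib power_mult)
    then show ?thesis
      by (simp add: h_def ennreal_mult[symmetric] Q_nonneg mult_ac)
  qed
  \<comment> \<open>Weights all equal to 1 give the squared norm, so the same Gaussian formula
    evaluates the radial integral, with the number of multisets in place of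
    \<open>S\<close>.\<close>
  moreover have "norm x ^ (2 * ?k) = (\<Sum>j\<in>UNIV. 1 * (cmod (U x $ j))\<^sup>2) ^ ?k" for x
  proof -
    have "(norm x)\<^sup>2 = (\<Sum>j\<in>UNIV. (cmod (U x $ j))\<^sup>2)"
      unfolding norm_U[of x, symmetric] by (simp add: norm_vec_def L2_set_def sum_nonneg)
    then show ?thesis by (simp add: power_mult)
  qed
  ultimately have "a * ennreal (c * (\<Sum>M\<in>?I. \<Prod>j\<in>#M. 1)) = emeasure lborel ?B * ennreal (c * S)"
    using gauss[of w] gauss[of "\<lambda>_. 1"] w by (simp add: Q_U S_def)
  moreover have "(\<Sum>M\<in>?I. \<Prod>j\<in>#M. 1) = real (card ?I)" by simp
  moreover have cardI: "card ?I = (CARD('n) + ?k - 1) choose ?k"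
    by (rule card_multisets_of_size) simp
  moreover have card_pos: "0 < card ?I"
    unfolding cardI by (rule zero_less_binomial) (use zero_less_card_finite[where 'a='n] in linarith)
  ultimately have eq: "a * ennreal (c * card ?I) = emeasure lborel ?B * ennreal (c * S)" by simp
  have "a / emeasure lborel ?B = ennreal (S / card ?I)"
  proof -
    obtain a' where a': "a = ennreal a'" "0 \<le> a'" using a_fin by (cases a) auto
    obtain v' where v': "emeasure lborel ?B = ennreal v'" "0 < v'"
      using v by (cases "emeasure lborel ?B") (auto simp: less_le)
    have "a' * (c * card ?I) = v' * (c * S)"
      using eq a' v' c_pos S_nonneg by (simp add: ennreal_mult[symmetric])
    then have "a' / v' = S / card ?I"
      using c_pos card_pos v' by (simp add: field_simps)
    then show ?thesis
      using a' v' by (simp add: divide_ennreal)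
  qed
  moreover have "(LINT \<xi>:sphere 0 1|sphere_measure. Q \<xi> powr ?k) = enn2real (a / emeasure lborel ?B)"
  proof -
    have Q0: "Q 0 = 0" by (simp add: Q_def hinner_linear)
    have "(LINT \<xi>:sphere 0 1|sphere_measure. Q \<xi> powr ?k) =
        (LINT x|uniform_measure lborel ?B. indicator (sphere 0 1) (sgn x) *\<^sub>R Q (sgn x) powr ?k)"
      unfolding set_lebesgue_integral_def sphere_measure_def
    proof (rule integral_distr)
      have [measurable]: "sphere (0 :: complex ^ 'n) 1 \<in> sets borel" by simp
      show "(\<lambda>\<xi>. indicator (sphere 0 1) \<xi> *\<^sub>R Q \<xi> powr ?k) \<in> borel_measurable borel"
        unfolding powr_def by measurable
    qed (use sgn_borel_measurable in simp)
    also have "\<dots> = (LINT x|uniform_measure lborel ?B. Q (sgn x) ^ ?k)"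
    proof (rule Bochner_Integration.integral_cong)
      fix x :: "complex ^ 'n"
      \<comment> \<open>At the origin \<open>sgn\<close> is zero, off the sphere, so the left side
        vanishes; the right side does too, as \<open>Q 0 = 0\<close> and \<open>?k\<close> is
        positive.\<close>
      show "indicator (sphere 0 1) (sgn x) *\<^sub>R Q (sgn x) powr ?k = Q (sgn x) ^ ?k"
        using Q_nonneg[of "sgn x"] by (cases "x = 0") (auto simp: Q0 powr_realpow' norm_sgn)
    qed simp
    also have "\<dots> = enn2real (\<integral>\<^sup>+x. h x \<partial>uniform_measure lborel ?B)"
      unfolding h_def by (rule integral_eq_nn_integral) (auto simp: Q_nonneg)
    also have "\<dots> = enn2real (a / emeasure lborel ?B)"
      by (subst nn_integral_uniform_measure) (auto simp: a_def)
    finally show ?thesis .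
  qed
  ultimately show ?thesis
    using S_nonneg by (simp add: Q_def S_def cardI)
qed

theorem proposition2p1:
  fixes A :: "complex ^ 'n::finite ^ 'n" and p :: real and k :: nat
  assumes "p \<ge> 1" and "k \<ge> 1" and "CARD('k::finite) = k"
  shows "real ((CARD('n) + k - 1) choose k) powr (1 / (real k * p)) * N_norm (real k) p A =
    schatten_norm p (sym_tensors :: (complex ^ ('k \<Rightarrow> 'n)) set) (sym_power A) powr (1 / real k)"
proof -
  obtain e :: "'n \<Rightarrow> complex ^ 'n" and s :: "'n \<Rightarrow> real"
    where e: "orthonormal_family UNIV e UNIV"
      and s: "\<And>j. (ctranspose A ** A) *v e j = of_real (s j) *s e j" "\<And>j. 0 \<le> s j"
    using gram_matrix_spectral[of A] by blast
  interpret orthonormal_family UNIV e UNIV by fact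
  define w where "w j = (s j powr (1/2)) powr p" for j
  define S where "S = (\<Sum>M\<in>multisets_of_size UNIV k. \<Prod>j\<in>#M. w j)"
  let ?c = "real ((CARD('n) + k - 1) choose k)"
  have w: "0 \<le> w j" for j by (simp add: w_def)
  have S: "0 \<le> S" unfolding S_def by (intro sum_nonneg) (simp add: prod_mset_power_count prod_nonneg w)
  have "k \<le> CARD('n) + k - 1"
    using zero_less_card_finite[where 'a='n] by linarith
  then have c: "0 < ?c" by simp
  \<comment> \<open>In the eigenbasis the form is a real weighted sum of squared moduli, so
    \<open>Re\<close> in \<open>N_norm\<close> discards nothing.\<close>
  have "hinner (op_powr UNIV (op_abs UNIV ((*v) A)) p \<xi>) \<xi> =
      of_real (\<Sum>j\<in>UNIV. w j * (cmod (hinner \<xi> (e j)))\<^sup>2)" for \<xi>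
  proof -
    have "hinner (op_powr UNIV (op_abs UNIV ((*v) A)) p \<xi>) \<xi> =
        (\<Sum>j\<in>UNIV. of_real (w j) * (hinner \<xi> (e j) * cnj (hinner \<xi> (e j))))"
      unfolding op_powr_abs_eq[OF e s(1)] by (simp add: hinner_linear w_def cnj_hinner mult.assoc)
    then show ?thesis
      by (simp flip: complex_norm_square)
  qed
  then have "N_norm (real k) p A = (S / ?c) powr (1 / (p * real k))"
    using sphere_measure_diagonal_form[OF e w, where 'k='k]
    by (simp add: N_norm_def S_def assms(3))
  \<comment> \<open>Both factors carry the same exponent, so the binomial coefficient cancels inside
    a single power.\<close>
  then have "?c powr (1 / (real k * p)) * N_norm (real k) p A = (?c * (S / ?c)) powr (1 / (p * real k))"
    using S c by (subst powr_mult) (simp_all add: mult.commute)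
  also have "\<dots> = (S powr (1 / p)) powr (1 / real k)"
    using c by (simp add: powr_powr)
  also have "S powr (1 / p) = schatten_norm p (sym_tensors :: (complex ^ ('k \<Rightarrow> 'n)) set) (sym_power A)"
    using schatten_norm_sym_power[OF e s, where 'k='k, of p] by (simp add: S_def w_def assms(3))
  finally show ?thesis .
qed

end
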